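(* Let $K$ be a field, $S=K[x_1,\dots,x_n]$, $d\ge2$, $\mathbf t=(t_1,\dots,t_{d-1})\in\mathbb Z_{\ge0}^{d-1}$, and let $I\subset S$ be a $\mathbf t$-spread strongly stable ideal. Let $P_I^S(y)=\sum_i\beta_i(I)y^i$ be the Poincaré series of $I$. Then (a) $P_I^S(y)=\sum_{u\in G(I)}(1+y)^{\max(u)-1-\sum_{\ell=1}^{\deg(u)-1}t_\ell}$; (b) $\operatorname{pd}(I)=\max\big\{\max(u)-1-\sum_{j=1}^{\deg(u)-1}t_j:u\in G(I)\big\}$; (c) $\operatorname{reg}(I)=\max\{\deg(u):u\in G(I)\}$.
   Context: A monomial $u=x_{j_1}\cdots x_{j_\ell}\in S$ with $j_1\le\dots\le j_\ell$ and $\ell\le d$ is $\mathbf t$-spread if $j_{r+1}-j_r\ge t_r$ for all $r=1,\dots,\ell-1$ (variables and $1$ are $\mathbf t$-spread). $G(I)$ denotes the minimal monomial generating set of a monomial ideal $I$. $I$ is a $\mathbf t$-spread monomial ideal if all $u\in G(I)$ are $\mathbf t$-spread; it is $\mathbf t$-spread strongly stable if moreover, for every $\mathbf t$-spread monomial $u\in I$ and all $j<i$ with $x_i\mid u$ and $x_j(u/x_i)$ $\mathbf t$-spread, one has $x_j(u/x_i)\in I$. For a monomial $u\neq 1$, $\max(u)=\max\{i:x_i\mid u\}$, and $\max(1)=n$ by convention. $\beta_{i,j}(I)=\dim_K\operatorname{Tor}_i^S(K,I)_j$, $\beta_i(I)=\sum_j\beta_{i,j}(I)$, $\operatorname{pd}(I)=\max\{i:\beta_i(I)\ne0\}$,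 and $\operatorname{reg}(I)=\max\{j:\beta_{i,i+j}(I)\ne0\text{ for some }i\}$.
   Formalization: The ideal I is assumed to be proper (I ≠ S): for I = S with n ≥ 2, G(I) = {1} and max(1) = n make (a) give (1+y)^{n-1} and (b) give n−1, whereas S is free, with Poincaré series 1 and projective dimension 0. *)

theory Defs
  imports
    "HOL-Algebra.Ideal"
    "HOL-Library.Poly_Mapping"
    "HOL-Library.Function_Algebras"
    "HOL-Computational_Algebra.Formal_Power_Series"
begin

text \<open>
  Polynomials are finitely supported maps from exponent vectors to coefficients. Exponent vectors
  have type \<open>nat \<Rightarrow>\<^sub>0 nat\<close> and are written additively, so multiplying monomials
  is \<open>+\<close> and the monomial \<open>1\<close> is \<open>0\<close>.
\<close>

type_synonym expo = "nat \<Rightarrow>\<^sub>0 nat"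
type_synonym 'k mpol = "expo \<Rightarrow>\<^sub>0 'k"

abbreviation "keys \<equiv> Poly_Mapping.keys"
abbreviation "lookup \<equiv> Poly_Mapping.lookup"

definition expos :: "nat \<Rightarrow> expo set" where
  "expos n = {u. keys u \<subseteq> {1..n}}"

definition poly_ring :: "nat \<Rightarrow> 'k::field mpol ring" where
  "poly_ring n = \<lparr>carrier = {p. keys p \<subseteq> expos n}, monoid.mult = (*), one = 1,
          zero = 0, add = (+)\<rparr>"

lemma cring_poly_ring: "cring (poly_ring n :: 'k::field mpol ring)"
proof -
  have mult: "keys (p * q) \<subseteq> expos n" if "keys p \<subseteq> expos n" "keys q \<subseteq> expos n"
    for p q :: "'k mpol"
  proof
    fix w assume "w \<in> keys (p * q)"
    then obtain u v where "w = u + v" "u \<in> keys p" "v \<in> keys q"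
      using keys_mult[of p q] by auto
    then show "w \<in> expos n"
      using that keys_add[of u v] unfolding expos_def by blast
  qed
  have "abelian_group (poly_ring n :: 'k mpol ring)"
  proof (rule abelian_groupI)
    fix p assume p: "p \<in> carrier (poly_ring n :: 'k mpol ring)"
    show "\<exists>q \<in> carrier (poly_ring n). q \<oplus>\<^bsub>poly_ring n\<^esub> p = \<zero>\<^bsub>poly_ring n\<^esub>"
      using p by (intro bexI[of _ "- p"]) (auto simp: poly_ring_def)
  qed (use keys_add in \<open>fastforce simp: poly_ring_def add_ac\<close>)+
  moreover have "comm_monoid (poly_ring n :: 'k mpol ring)"
    by (rule comm_monoidI)
       (use mult in \<open>force simp: poly_ring_def mult_ac\<close>, auto simp: poly_ring_def mult_ac expos_def)
  ultimately show ?thesis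
    by (rule cringI) (simp add: poly_ring_def distrib_right)
qed

definition monom :: "expo \<Rightarrow> 'k::field mpol" where
  "monom u = Poly_Mapping.single u 1"

definition deg :: "expo \<Rightarrow> nat" where
  "deg u = (\<Sum>i\<in>keys u. lookup u i)"

definition max_var :: "nat \<Rightarrow> expo \<Rightarrow> nat" where
  "max_var n u = (if u = 0 then n else Max (keys u))"


section \<open>Monomial ideals\<close>

definition monomial_ideal :: "nat \<Rightarrow> 'k::field mpol set \<Rightarrow> bool" where
  "monomial_ideal n I \<longleftrightarrow> (\<exists>A \<subseteq> expos n. I = genideal (poly_ring n) (monom ` A))"

text \<open>The unique minimal set of monomials generating a monomial ideal.\<close>

definition min_gens :: "nat \<Rightarrow> 'k::field mpol set \<Rightarrow> expo set" where
  "min_gens n I = (THE G. G \<subseteq> expos n \<and> genideal (poly_ring n) (monom ` G) = I \<and>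
     (\<forall>H. H \<subset> G \<longrightarrow> genideal (poly_ring n) (monom ` H) \<noteq> I))"

text \<open>The sequence \<open>t\<close> is indexed from 1 (only \<open>t 1, \<dots>, t (d - 1)\<close> matter), whereas
  lists are indexed from 0: \<open>js ! (r - 1)\<close> is the index $j_r$ and \<open>js ! r\<close>
  is $j_{r+1}$.\<close>

definition t_spread :: "nat \<Rightarrow> nat \<Rightarrow> (nat \<Rightarrow> nat) \<Rightarrow> expo \<Rightarrow> bool" where
  "t_spread n d t u \<longleftrightarrow> u \<in> expos n \<and>
     (\<exists>js. sorted js \<and> u = (\<Sum>j\<leftarrow>js. Poly_Mapping.single j 1) \<and> length js \<le> d \<and>
        (\<forall>r\<in>{1..<length js}. js ! (r - 1) + t r \<le> js ! r))"

definition t_spread_ideal ::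
    "nat \<Rightarrow> nat \<Rightarrow> (nat \<Rightarrow> nat) \<Rightarrow> 'k::field mpol set \<Rightarrow> bool" where
  "t_spread_ideal n d t I \<longleftrightarrow>
     monomial_ideal n I \<and> (\<forall>u \<in> min_gens n I. t_spread n d t u)"

definition t_spread_strongly_stable ::
    "nat \<Rightarrow> nat \<Rightarrow> (nat \<Rightarrow> nat) \<Rightarrow> 'k::field mpol set \<Rightarrow> bool" where
  "t_spread_strongly_stable n d t I \<longleftrightarrow> t_spread_ideal n d t I \<and>
     (\<forall>u i j. t_spread n d t u \<and> monom u \<in> I \<and> i \<in> keys u \<and> j < i \<and>
        t_spread n d t (u - Poly_Mapping.single i 1 + Poly_Mapping.single j 1) \<longrightarrow>
        monom (u - Poly_Mapping.single i 1 + Poly_Mapping.single j 1) \<in> I)"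

text \<open>By the following lemma, the truncated difference \<open>max_var n u - 1 - (\<Sum>l = 1..deg u - 1. t l)\<close>
  involves no truncation when \<open>u \<noteq> 0\<close> is t-spread.\<close>

lemma t_spread_max_var_ge:
  assumes "t_spread n d t u" "u \<noteq> 0"
  shows "1 + (\<Sum>l = 1..deg u - 1. t l) \<le> max_var n u"
proof -
  obtain js where js: "sorted js" "u = (\<Sum>j\<leftarrow>js. Poly_Mapping.single j 1)"
      "\<forall>r\<in>{1..<length js}. js ! (r - 1) + t r \<le> js ! r" and un: "u \<in> expos n"
    using assms(1) unfolding t_spread_def by blast
  have lk: "lookup (\<Sum>j\<leftarrow>xs. Poly_Mapping.single j 1) i = count_list xs i"
    for xs :: "nat list" and i
    by (induction xs) (auto simp: lookup_add lookup_single when_def)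
  have keys: "keys u = set js"
    unfolding js(2) by (auto simp: in_keys_iff lk[unfolded One_nat_def] count_list_0_iff)
  have deg: "deg u = length js"
    unfolding deg_def keys using sum_count_set[of js "set js"]
    by (simp add: js(2) ext[OF lk, unfolded One_nat_def])
  have ne: "js \<noteq> []" using assms(2) js(2) by auto
  have step: "1 + (\<Sum>l = 1..m. t l) \<le> js ! m" if "m < length js" for m
    using that
  proof (induction m)
    case 0
    have "js ! 0 \<in> keys u" using ne keys by simp
    then show ?case using un by (auto simp: expos_def)
  next
    case (Suc m)
    have "js ! m + t (Suc m) \<le> js ! Suc m" using js(3)[rule_format, of "Suc m"] Suc.prems by simp
    then show ?case using Suc by simp
  qed
  have "1 + (\<Sum>l = 1..length js - 1. t l) \<le> js ! (length js - 1)" using step ne by simp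
  also have "\<dots> \<le> Max (set js)" using ne by (intro Max_ge) auto
  finally show ?thesis using assms(2) by (simp add: max_var_def keys deg)
qed


section \<open>Graded Betti numbers\<close>

text \<open>
  Data of a complex $\cdots \to F_1 \to F_0 \to S$ of graded free modules of finite rank:
  $F_i = \bigoplus_{k < r_i} S(-\delta_{i,k})$ with \<open>rank i\<close> $= r_i$ and
  \<open>shift i k\<close> $= \delta_{i,k}$, the degree of the \<open>k\<close>-th basis element.
  The augmentation sends the \<open>k\<close>-th basis element of $F_0$ to \<open>aug k\<close>;
  \<open>dmat i l k\<close> is the entry in row \<open>l\<close> and column \<open>k\<close> of the matrix of
  $\partial_{i+1} : F_{i+1} \to F_i$.
\<close>

record (overloaded) 'k free_complex =
  rank :: "nat \<Rightarrow> nat"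
  shift :: "nat \<Rightarrow> nat \<Rightarrow> int"
  aug :: "nat \<Rightarrow> 'k mpol"
  dmat :: "nat \<Rightarrow> nat \<Rightarrow> nat \<Rightarrow> 'k mpol"

definition homog :: "nat \<Rightarrow> int \<Rightarrow> 'k::field mpol set" where
  "homog n e = {p \<in> carrier (poly_ring n). \<forall>u\<in>keys p. int (deg u) = e}"

definition free_mod :: "nat \<Rightarrow> 'k::field free_complex \<Rightarrow> nat \<Rightarrow> (nat \<Rightarrow> 'k mpol) set" where
  "free_mod n F i =
     {v. (\<forall>k < rank F i. v k \<in> carrier (poly_ring n)) \<and> (\<forall>k \<ge> rank F i. v k = 0)}"

definition aug_map :: "'k::field free_complex \<Rightarrow> (nat \<Rightarrow> 'k mpol) \<Rightarrow> 'k mpol" where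
  "aug_map F v = (\<Sum>k < rank F 0. v k * aug F k)"

definition diff_map ::
    "'k::field free_complex \<Rightarrow> nat \<Rightarrow> (nat \<Rightarrow> 'k mpol) \<Rightarrow> (nat \<Rightarrow> 'k mpol)" where
  "diff_map F i v = (\<lambda>l. if l < rank F i then \<Sum>k < rank F (Suc i). v k * dmat F i l k else 0)"

definition graded_free_resolution ::
    "nat \<Rightarrow> 'k::field mpol set \<Rightarrow> 'k free_complex \<Rightarrow> bool" where
  "graded_free_resolution n I F \<longleftrightarrow>
     (\<forall>k < rank F 0. aug F k \<in> homog n (shift F 0 k)) \<and>
     (\<forall>i. \<forall>l < rank F i. \<forall>k < rank F (Suc i).
        dmat F i l k \<in> homog n (shift F (Suc i) k - shift F i l)) \<and>
     aug_map F ` free_mod n F 0 = I \<and>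
     {v \<in> free_mod n F 0. aug_map F v = 0} = diff_map F 0 ` free_mod n F 1 \<and>
     (\<forall>i. {v \<in> free_mod n F (Suc i). diff_map F i v = 0}
            = diff_map F (Suc i) ` free_mod n F (Suc (Suc i)))"

text \<open>
  $K \otimes_S F_i$ is $\bigoplus_{k<r_i} K(-\delta_{i,k})$, and the matrix of
  $K \otimes \partial_{i+1}$ consists of the constant terms of the entries of the matrix of
  $\partial_{i+1}$. Below are the degree \<open>j\<close> part of $K \otimes_S F_i$, its cycles and
  its boundaries.
\<close>

definition K_mod :: "'k::field free_complex \<Rightarrow> nat \<Rightarrow> int \<Rightarrow> (nat \<Rightarrow> 'k) set" where
  "K_mod F i j = {c. \<forall>k. c k \<noteq> 0 \<longrightarrow> k < rank F i \<and> shift F i k = j}"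

definition K_diff :: "'k::field free_complex \<Rightarrow> nat \<Rightarrow> (nat \<Rightarrow> 'k) \<Rightarrow> (nat \<Rightarrow> 'k)" where
  "K_diff F i c =
     (\<lambda>l. if l < rank F i then \<Sum>k < rank F (Suc i). c k * lookup (dmat F i l k) 0 else 0)"

fun K_cycles :: "'k::field free_complex \<Rightarrow> nat \<Rightarrow> int \<Rightarrow> (nat \<Rightarrow> 'k) set" where
  "K_cycles F 0 j = K_mod F 0 j"
| "K_cycles F (Suc i) j = {c \<in> K_mod F (Suc i) j. K_diff F i c = 0}"

definition K_bounds :: "'k::field free_complex \<Rightarrow> nat \<Rightarrow> int \<Rightarrow> (nat \<Rightarrow> 'k) set" where
  "K_bounds F i j = K_diff F i ` K_mod F (Suc i) j"

lemma vector_space_K: "vector_space (\<lambda>(a::'k::field) (c :: nat \<Rightarrow> 'k) k. a * c k)"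
  by unfold_locales (auto simp: fun_eq_iff algebra_simps)

definition dim_K :: "(nat \<Rightarrow> 'k::field) set \<Rightarrow> nat" where
  "dim_K = vector_space.dim (\<lambda>a c k. a * c k)"

text \<open>
  \<open>tor_dim F i j\<close> is $\dim_K H_i(K \otimes_S F)_j$; the spaces involved are finite-dimensional
  and the boundaries are contained in the cycles. For a graded free resolution \<open>F\<close> of \<open>I\<close>
  this is $\dim_K \mathrm{Tor}_i^S(K, I)_j$. As always for derived functors the resolution is
  arbitrary but fixed; here it is picked by \<open>SOME\<close>. Resolutions by modules of finite rank
  exist since \<open>poly_ring n\<close> is Noetherian.
\<close>

definition tor_dim :: "'k::field free_complex \<Rightarrow> nat \<Rightarrow> int \<Rightarrow> nat" where
  "tor_dim F i j = dim_K (K_cycles F i j) - dim_K (K_bounds F i j)"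

definition betti :: "nat \<Rightarrow> 'k::field mpol set \<Rightarrow> nat \<Rightarrow> int \<Rightarrow> nat" where
  "betti n I = tor_dim (SOME F. graded_free_resolution n I F)"

definition total_betti :: "nat \<Rightarrow> 'k::field mpol set \<Rightarrow> nat \<Rightarrow> nat" where
  "total_betti n I i = (\<Sum>j | betti n I i j \<noteq> 0. betti n I i j)"

definition poincare_series :: "nat \<Rightarrow> 'k::field mpol set \<Rightarrow> int fps" where
  "poincare_series n I = Abs_fps (\<lambda>i. int (total_betti n I i))"

definition pd :: "nat \<Rightarrow> 'k::field mpol set \<Rightarrow> nat" where
  "pd n I = Max {i. total_betti n I i \<noteq> 0}"

definition reg :: "nat \<Rightarrow> 'k::field mpol set \<Rightarrow> int" where
  "reg n I = Max {j. \<exists>i. betti n I i (int i + j) \<noteq> 0}"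

end

theory Submission
  imports Defs "HOL-Library.Product_Lexorder"
begin

text \<open>
  Ordered by degree, and within a degree by the sum of the indices of the variables, the minimal
  generators of a t-spread strongly stable ideal have linear quotients: the colon ideal of the
  earlier generators by \<open>u\<close> is generated by
  \<open>max u - 1 - (t\<^sub>1 + \<dots> + t\<^sub>l\<^sub>-\<^sub>1)\<close> variables, where \<open>l = deg u\<close>.
  Adding the generators one at a time and taking mapping cones yields a free resolution in which
  \<open>u\<close> contributes a Koszul complex on these variables, shifted by \<open>l\<close>. It is minimal
  for degree reasons because the degrees of the generators increase along the order. The Koszul
  complexes themselves are iterated mapping cones as well. Chain maps and homotopies between any
  two graded free resolutions show that the Betti numbers may be read off from this one.
\<close>

section \<open>Homogeneous polynomials\<close>

text \<open>\<open>betti\<close> evaluates an unknown resolution picked by \<open>SOME\<close>, so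
  exhibiting a minimal one is not enough: the comparison has to cover arbitrary graded free
  resolutions, and only dimensions of homology survive it. The number of variables comes from
  counting indices. Let u have the indices j_1, ..., j_l and let i < max u. Replacing the first j_k
  > i by i keeps the spread condition exactly when i avoids the blocks from j_r to j_r + t_r - 1 for
  r < l. These blocks are disjoint and lie below max u, which leaves max u - 1 - (t_1 + ... +
  t_{l-1}) values of i. The index sum serves as second key because such a replacement lowers it, so
  that x_i u is a multiple of an earlier generator. Conversely, where the index list of an earlier
  generator first drops below that of u, it shows such an index i.\<close>

lemma carrier_poly_ring: "carrier (poly_ring n) = {p :: 'k::field mpol. keys p \<subseteq> expos n}"
  by (simp add: poly_ring_def)

lemma expos_add: "u \<in> expos n \<Longrightarrow> v \<in> expos n \<Longrightarrow> u + v \<in> expos n"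
  using keys_add[of u v] unfolding expos_def by blast

lemma zero_expos [simp]: "0 \<in> expos n"
  by (simp add: expos_def)

lemma keys_plus_expo: "keys (u + v :: expo) = keys u \<union> keys v"
  by (auto simp: in_keys_iff lookup_add)

lemma deg_add: "deg (u + v) = deg u + deg v"
proof -
  have *: "deg w = (\<Sum>i\<in>keys u \<union> keys v. lookup w i)" if "keys w \<subseteq> keys u \<union> keys v" for w
    unfolding deg_def using that by (intro sum.mono_neutral_left) (auto simp: in_keys_iff)
  show ?thesis
    by (subst (1 2 3) *) (auto simp: keys_plus_expo lookup_add sum.distrib)
qed

lemma deg_zero [simp]: "deg 0 = 0"
  by (simp add: deg_def)

lemma deg_single [simp]: "deg (Poly_Mapping.single i m) = m"
  by (cases "m = 0") (auto simp: deg_def)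

lemma deg_eq_0_iff [simp]: "deg u = 0 \<longleftrightarrow> u = 0"
  unfolding deg_def by (auto simp: in_keys_iff intro!: poly_mapping_eqI)

lemma mpol_mult_closed:
  fixes p q :: "'k::field mpol"
  assumes "keys p \<subseteq> expos n" "keys q \<subseteq> expos n"
  shows "keys (p * q) \<subseteq> expos n"
  using keys_mult[of p q] assms expos_add by blast

lemma mpol_add_closed:
  fixes p q :: "'k::field mpol"
  assumes "keys p \<subseteq> V" "keys q \<subseteq> V"
  shows "keys (p + q) \<subseteq> V"
  using keys_add[of p q] assms by blast

lemma keys_uminus_mpol [simp]: "keys (- p :: 'k::field mpol) = keys p"
  by (auto simp: in_keys_iff)

lemma mpol_diff_closed:
  fixes p q :: "'k::field mpol"
  assumes "keys p \<subseteq> V" "keys q \<subseteq> V"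
  shows "keys (p - q) \<subseteq> V"
  using mpol_add_closed[of p V "- q"] assms by simp

lemma mpol_sum_closed:
  fixes f :: "'b \<Rightarrow> 'k::field mpol"
  assumes "\<And>x. x \<in> A \<Longrightarrow> keys (f x) \<subseteq> V"
  shows "keys (sum f A) \<subseteq> V"
  using assms by (induction A rule: infinite_finite_induct) (simp_all add: mpol_add_closed)

lemma homog_iff: "p \<in> homog n e \<longleftrightarrow> keys p \<subseteq> expos n \<inter> {u. int (deg u) = e}"
  by (auto simp: homog_def carrier_poly_ring)

lemma homog_carrier: "p \<in> homog n e \<Longrightarrow> p \<in> carrier (poly_ring n)"
  by (simp add: homog_def)

lemma homog_zero [simp]: "0 \<in> homog n e"
  by (simp add: homog_iff)

lemma homog_add: "p \<in> homog n e \<Longrightarrow> q \<in> homog n e \<Longrightarrow> p + q \<in> homog n e"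
  unfolding homog_iff by (rule mpol_add_closed)

lemma homog_uminus: "p \<in> homog n e \<Longrightarrow> - p \<in> homog n e"
  by (simp add: homog_iff)

lemma homog_sum: "(\<And>x. x \<in> A \<Longrightarrow> f x \<in> homog n e) \<Longrightarrow> sum f A \<in> homog n e"
  unfolding homog_iff by (rule mpol_sum_closed)

lemma homog_mult:
  assumes "p \<in> homog n a" "q \<in> homog n b"
  shows "p * q \<in> homog n (a + b)"
proof -
  have "w \<in> expos n \<and> int (deg w) = a + b" if w: "w \<in> keys (p * q)" for w
  proof -
    obtain u v where "w = u + v" "u \<in> keys p" "v \<in> keys q"
      using w keys_mult[of p q] by blast
    then show ?thesis
      using assms by (auto simp: homog_iff deg_add subset_iff intro: expos_add)
  qed
  then show ?thesis unfolding homog_iff by blast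
qed

lemma homog_one: "1 \<in> homog n 0"
  by (simp add: homog_iff)

lemma homog_monom: "u \<in> expos n \<Longrightarrow> monom u \<in> homog n (int (deg u))"
  by (simp add: homog_iff monom_def)

lemma homog_pos_lookup_0: "p \<in> homog n e \<Longrightarrow> e \<noteq> 0 \<Longrightarrow> lookup p 0 = 0"
  by (auto simp: homog_iff in_keys_iff subset_iff)

lemma zero_eq_add_expo: "(0::expo) = u + v \<longleftrightarrow> u = 0 \<and> v = 0"
  by (metis add.right_neutral add_is_0 deg_add deg_eq_0_iff)

text \<open>The exponent 0 splits only as 0 + 0. So taking constant terms is multiplicative, which
  is what reducing matrices modulo the variables rests on.\<close>

lemma lookup_mult_0: "lookup (p * q :: 'k::field mpol) 0 = lookup p 0 * lookup q 0"
proof -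
  have "(lookup q v when 0 = u + v) = ((lookup q 0 when u = 0) when v = 0)" for u v :: expo
    unfolding zero_eq_add_expo by (cases "u = 0"; cases "v = 0"; simp add: when_def)
  then have "Sum_any (\<lambda>v. lookup q v when 0 = u + v) = (lookup q 0 when u = 0)" for u :: expo
    by (simp only: Sum_any_when_equal)
  then have "lookup (p * q) 0 = Sum_any (\<lambda>u. lookup p u * (lookup q 0 when u = 0))"
    unfolding lookup_mult by presburger
  then show ?thesis
    by (simp only: mult_when Sum_any_when_equal)
qed

section \<open>Homogeneous components of polynomials\<close>

lift_definition hom_part :: "int \<Rightarrow> 'k::field mpol \<Rightarrow> 'k mpol" is
  "\<lambda>e f u. if int (deg u) = e then f u else 0"
  by (rule finite_subset) auto

lemma lookup_hom_part: "lookup (hom_part e p) u = (if int (deg u) = e then lookup p u else 0)"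
  by (simp add: hom_part.rep_eq)

lemma hom_part_add: "hom_part e (p + q) = hom_part e p + hom_part e q"
  by (rule poly_mapping_eqI) (simp add: lookup_hom_part lookup_add)

lemma hom_part_zero [simp]: "hom_part e 0 = 0"
  by (rule poly_mapping_eqI) (simp add: lookup_hom_part)

lemma hom_part_sum: "hom_part e (sum f A) = (\<Sum>x\<in>A. hom_part e (f x))"
  by (induction A rule: infinite_finite_induct) (auto simp: hom_part_add)

lemma hom_part_homog: "p \<in> carrier (poly_ring n) \<Longrightarrow> hom_part e p \<in> homog n e"
  by (auto simp: homog_iff carrier_poly_ring in_keys_iff lookup_hom_part subset_iff split: if_splits)

lemma hom_part_id: "p \<in> homog n e \<Longrightarrow> hom_part e p = p"
  by (rule poly_mapping_eqI) (auto simp: homog_iff in_keys_iff lookup_hom_part subset_iff)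

lemma hom_part_split: "\<exists>q. p = hom_part e p + q \<and> hom_part e q = 0 \<and> keys q \<subseteq> keys p"
  by (intro exI[of _ "p - hom_part e p"] conjI)
     (auto intro!: poly_mapping_eqI simp: lookup_hom_part lookup_minus in_keys_iff split: if_splits)

text \<open>Only the part of \<open>p\<close> of degree \<open>e - a\<close> can contribute to
  degree \<open>e\<close> of the product; all other terms land in other degrees. This allows
  homogeneous components to be taken inside matrix products.\<close>

lemma hom_part_mult:
  assumes "q \<in> homog n a" "p \<in> carrier (poly_ring n)"
  shows "hom_part e (q * p) = q * hom_part (e - a) p"
proof -
  obtain r where r: "p = hom_part (e - a) p + r" "hom_part (e - a) r = 0" "keys r \<subseteq> keys p"
    using hom_part_split by blast
  have 1: "hom_part e (q * hom_part (e - a) p) = q * hom_part (e - a) p"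
    using homog_mult[OF assms(1) hom_part_homog[OF assms(2)], of "e - a"] by (auto intro: hom_part_id)
  \<comment> \<open>The negation of \<open>int (deg w) = e\<close>, spelled out because
    \<open>e\<close> may be negative.\<close>
  have "deg w \<noteq> nat e \<or> e < 0" if w: "w \<in> keys (q * r)" for w
  proof -
    obtain u v where uv: "w = u + v" "u \<in> keys q" "v \<in> keys r"
      using w keys_mult[of q r] by blast
    have "int (deg v) \<noteq> e - a"
      using arg_cong[OF r(2), of "\<lambda>p. lookup p v"] uv(3) by (auto simp: lookup_hom_part in_keys_iff)
    moreover have "int (deg u) = a" using assms(1) uv(2) by (auto simp: homog_iff)
    ultimately show ?thesis using uv by (auto simp: deg_add)
  qed
  then have 2: "hom_part e (q * r) = 0"
    by (intro poly_mapping_eqI) (force simp: lookup_hom_part in_keys_iff)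
  show ?thesis
    by (subst r(1)) (simp only: distrib_left hom_part_add 1 2 add_0_right)
qed

section \<open>Matrices over the polynomial ring\<close>

text \<open>Matrices are total functions and \<open>c\<close> is only the range of summation.
  Products are thus associative without side conditions on sizes; sizes enter through the vanishing
  of entries in \<open>hmat\<close>.\<close>

definition mmul :: "nat \<Rightarrow> (nat \<Rightarrow> nat \<Rightarrow> 'a::comm_ring_1) \<Rightarrow> (nat \<Rightarrow> nat \<Rightarrow> 'a) \<Rightarrow> nat \<Rightarrow> nat \<Rightarrow> 'a" where
  "mmul c A B = (\<lambda>l k. \<Sum>j<c. A l j * B j k)"

definition mvec :: "nat \<Rightarrow> (nat \<Rightarrow> nat \<Rightarrow> 'a::comm_ring_1) \<Rightarrow> (nat \<Rightarrow> 'a) \<Rightarrow> nat \<Rightarrow> 'a" where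
  "mvec c A v = (\<lambda>l. \<Sum>j<c. A l j * v j)"

lemma mvec_mmul: "mvec d (mmul c A B) v = mvec c A (mvec d B v)"
proof
  fix l
  have "mvec d (mmul c A B) v l = (\<Sum>k<d. \<Sum>j<c. A l j * B j k * v k)"
    by (simp add: mvec_def mmul_def sum_distrib_right)
  also have "\<dots> = mvec c A (mvec d B v) l"
    by (subst sum.swap) (simp add: mvec_def sum_distrib_left mult.assoc)
  finally show "mvec d (mmul c A B) v l = mvec c A (mvec d B v) l" .
qed

lemma mmul_column: "(\<lambda>l. mmul c A B l k) = mvec c A (\<lambda>j. B j k)"
  by (simp add: mmul_def mvec_def)

lemma mmul_assoc: "mmul d (mmul c A B) C = mmul c A (mmul d B C)"
proof -
  have "(\<lambda>l. mmul d (mmul c A B) C l k) = (\<lambda>l. mmul c A (mmul d B C) l k)" for k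
    by (simp add: mmul_column mvec_mmul)
  then show ?thesis by (simp add: fun_eq_iff)
qed

lemma mmul_add_left: "mmul c (A + A') B = mmul c A B + mmul c A' B"
  by (simp add: mmul_def fun_eq_iff distrib_right sum.distrib)

lemma mmul_add_right: "mmul c A (B + B') = mmul c A B + mmul c A B'"
  by (simp add: mmul_def fun_eq_iff distrib_left sum.distrib)

lemma mmul_uminus_left: "mmul c (- A) B = - mmul c A B"
  by (simp add: mmul_def fun_eq_iff sum_negf fun_Compl_def)

lemma mmul_uminus_right: "mmul c A (- B) = - mmul c A B"
  by (simp add: mmul_def fun_eq_iff sum_negf fun_Compl_def)

lemma mmul_diff_left: "mmul c (A - A') B = mmul c A B - mmul c A' B"
  by (simp add: mmul_def fun_eq_iff left_diff_distrib sum_subtractf fun_diff_def)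

lemma mmul_diff_right: "mmul c A (B - B') = mmul c A B - mmul c A B'"
  by (simp add: mmul_def fun_eq_iff right_diff_distrib sum_subtractf fun_diff_def)

lemma mmul_zero [simp]: "mmul c A 0 = 0" "mmul c 0 A = 0"
  by (simp_all add: mmul_def fun_eq_iff)

lemma mvec_add: "mvec c A (v + w) = mvec c A v + mvec c A w"
  by (simp add: mvec_def fun_eq_iff distrib_left sum.distrib)

lemma mvec_add_left: "mvec c (A + B) v = mvec c A v + mvec c B v"
  by (simp add: mvec_def fun_eq_iff distrib_right sum.distrib)

lemma mvec_diff: "mvec c A (v - w) = mvec c A v - mvec c A w"
  by (simp add: mvec_def fun_eq_iff right_diff_distrib sum_subtractf fun_diff_def)

lemma mvec_diff_left: "mvec c (A - B) v = mvec c A v - mvec c B v"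
  by (simp add: mvec_def fun_eq_iff left_diff_distrib sum_subtractf fun_diff_def)

lemma mvec_uminus_left: "mvec c (- A) v = - mvec c A v"
  by (simp add: mvec_def fun_eq_iff sum_negf fun_Compl_def)

lemma mvec_zero [simp]: "mvec c A 0 = 0" "mvec c 0 v = 0"
  by (simp_all add: mvec_def fun_eq_iff)

section \<open>Degree-preserving matrices between graded free modules\<close>

definition idm :: "nat \<Rightarrow> nat \<Rightarrow> nat \<Rightarrow> 'a::comm_ring_1" where
  "idm c = (\<lambda>l k. if l = k \<and> l < c then 1 else 0)"

definition vecs :: "nat \<Rightarrow> nat \<Rightarrow> (nat \<Rightarrow> 'k::field mpol) set" where
  "vecs n r = {v. (\<forall>k<r. v k \<in> carrier (poly_ring n)) \<and> (\<forall>k\<ge>r. v k = 0)}"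

text \<open>The matrix of a degree-preserving map from the sum of the S(-s' k), k < c, to the sum of
  the S(-s l), l < r. Entries outside this range are zero, so that equal maps are equal
  functions.\<close>

definition hmat :: "nat \<Rightarrow> nat \<Rightarrow> (nat \<Rightarrow> int) \<Rightarrow> nat \<Rightarrow> (nat \<Rightarrow> int) \<Rightarrow> (nat \<Rightarrow> nat \<Rightarrow> 'k::field mpol) \<Rightarrow> bool" where
  "hmat n r s c s' M \<longleftrightarrow> (\<forall>l k. M l k \<in> (if l < r \<and> k < c then homog n (s' k - s l) else {0}))"

definition hvec :: "nat \<Rightarrow> nat \<Rightarrow> (nat \<Rightarrow> int) \<Rightarrow> int \<Rightarrow> (nat \<Rightarrow> 'k::field mpol) \<Rightarrow> bool" where
  "hvec n r s e v \<longleftrightarrow> (\<forall>l. v l \<in> (if l < r then homog n (e - s l) else {0}))"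

lemma hvec_vecs: "hvec n r s e v \<Longrightarrow> v \<in> vecs n r"
  unfolding hvec_def vecs_def mem_Collect_eq by (metis homog_carrier leD singletonD)

lemma vecs_zero [simp]: "0 \<in> vecs n r"
  by (simp add: vecs_def carrier_poly_ring)

lemma vecs_add: "v \<in> vecs n r \<Longrightarrow> w \<in> vecs n r \<Longrightarrow> v + w \<in> vecs n r"
  by (simp add: vecs_def carrier_poly_ring mpol_add_closed)

lemma vecs_diff: "v \<in> vecs n r \<Longrightarrow> w \<in> vecs n r \<Longrightarrow> v - w \<in> vecs n r"
  by (simp add: vecs_def carrier_poly_ring mpol_diff_closed)

lemma hmatI:
  assumes "\<And>l k. l < r \<Longrightarrow> k < c \<Longrightarrow> M l k \<in> homog n (s' k - s l)"
    and "\<And>l k. \<not> (l < r \<and> k < c) \<Longrightarrow> M l k = 0"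
  shows "hmat n r s c s' M"
  using assms unfolding hmat_def by auto

lemma hmat_column: "hmat n r s c s' M \<Longrightarrow> k < c \<Longrightarrow> hvec n r s (s' k) (\<lambda>l. M l k)"
  unfolding hmat_def hvec_def by presburger

lemma hmat_outside: "hmat n r s c s' M \<Longrightarrow> \<not> (l < r \<and> k < c) \<Longrightarrow> M l k = 0"
  unfolding hmat_def by (metis singletonD)

lemma hmat_entry: "hmat n r s c s' M \<Longrightarrow> l < r \<Longrightarrow> k < c \<Longrightarrow> M l k \<in> homog n (s' k - s l)"
  unfolding hmat_def by metis

lemma hmat_carrier: "hmat n r s c s' M \<Longrightarrow> M l k \<in> carrier (poly_ring n)"
  unfolding hmat_def by (metis homog_carrier homog_zero singletonD)

lemma mvec_vecs:
  assumes "hmat n r s c s' M" "v \<in> vecs n c"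
  shows "mvec c M v \<in> vecs n r"
proof -
  have "keys (M l j * v j) \<subseteq> expos n" if "j < c" for l j
    using hmat_carrier[OF assms(1), of l j] assms(2) that
    by (intro mpol_mult_closed) (auto simp: vecs_def carrier_poly_ring)
  then have "keys (mvec c M v l) \<subseteq> expos n" for l
    unfolding mvec_def by (intro mpol_sum_closed) auto
  moreover have "M l j = 0" if "l \<ge> r" for l j
    using hmat_outside[OF assms(1), of l j] that by simp
  ultimately show ?thesis
    by (auto simp: vecs_def carrier_poly_ring) (auto simp: mvec_def)
qed

lemma hmat_mmul:
  assumes A: "hmat n r s c s' A" and B: "hmat n c s' d s'' B"
  shows "hmat n r s d s'' (mmul c A B)"
proof -
  have "A l j * B j k \<in> homog n (s'' k - s l)" if "l < r" "k < d" "j < c" for l k j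
    using homog_mult[OF hmat_entry[OF A] hmat_entry[OF B], of l j j k] that by simp
  moreover have "A l j * B j k = 0" if "\<not> (l < r \<and> k < d)" for l k j
    using hmat_outside[OF A, of l j] hmat_outside[OF B, of j k] that by auto
  ultimately show ?thesis
    unfolding hmat_def mmul_def by (auto intro!: homog_sum sum.neutral)
qed

lemma hmat_add: "hmat n r s c s' A \<Longrightarrow> hmat n r s c s' B \<Longrightarrow> hmat n r s c s' (A + B)"
  by (rule hmatI) (simp_all add: homog_add hmat_entry hmat_outside)

lemma hmat_uminus: "hmat n r s c s' A \<Longrightarrow> hmat n r s c s' (- A)"
  by (rule hmatI) (simp_all add: homog_uminus hmat_entry hmat_outside)

lemma hmat_diff: "hmat n r s c s' A \<Longrightarrow> hmat n r s c s' B \<Longrightarrow> hmat n r s c s' (A - B)"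
  using hmat_add[of n r s c s' A "- B"] hmat_uminus[of n r s c s' B]
  by (simp add: fun_diff_def fun_Compl_def plus_fun_def)

lemma hmat_zero [simp]: "hmat n r s c s' 0"
  by (simp add: hmat_def)

lemma hmat_idm: "hmat n r s r s (idm r)"
  by (auto simp: hmat_def idm_def homog_one)

lemma hmat_shift: "hmat n r s c s' M \<Longrightarrow> hmat n r (\<lambda>k. s k + e) c (\<lambda>k. s' k + e) M"
  by (rule hmatI) (simp_all add: hmat_outside, use hmat_entry in fastforce)

lemma mmul_idm_right:
  assumes "hmat n r s c s' A"
  shows "mmul c A (idm c) = A"
proof (rule ext)+
  fix l k
  have "mmul c A (idm c) l k = (\<Sum>j<c. if j = k then A l k else 0)"
    unfolding mmul_def idm_def by (intro sum.cong) auto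
  then show "mmul c A (idm c) l k = A l k"
    using hmat_outside[OF assms, of l k] by simp
qed

lemma mmul_idm_left:
  assumes "hmat n r s c s' A"
  shows "mmul r (idm r) A = A"
proof (rule ext)+
  fix l k
  have "mmul r (idm r) A l k = (\<Sum>j<r. if j = l then A l k else 0)"
    unfolding mmul_def idm_def by (intro sum.cong) auto
  then show "mmul r (idm r) A l k = A l k"
    using hmat_outside[OF assms, of l k] by simp
qed

section \<open>Lifting through exact complexes\<close>

text \<open>Take from each coordinate \<open>w k\<close> its component of degree
  \<open>e - s' k\<close>. As \<open>M\<close> preserves degrees and \<open>v\<close> has degree
  \<open>e\<close>, this truncation of \<open>w\<close> is still a preimage.\<close>

lemma homogeneous_preimage:
  assumes M: "hmat n r s c s' M" and v: "hvec n r s e v" and w: "w \<in> vecs n c" "v = mvec c M w"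
  obtains w' where "hvec n c s' e w'" "v = mvec c M w'"
proof -
  define w' where "w' = (\<lambda>k. hom_part (e - s' k) (w k))"
  have "hvec n c s' e w'"
    using w(1) by (auto simp: hvec_def w'_def vecs_def hom_part_homog)
  moreover have "v l = mvec c M w' l" for l
  proof (cases "l < r")
    case True
    have "v l \<in> homog n (e - s l)" using v True unfolding hvec_def by metis
    then have "v l = hom_part (e - s l) (mvec c M w l)"
      using w(2) by (simp add: hom_part_id)
    also have "\<dots> = (\<Sum>k<c. M l k * hom_part (e - s' k) (w k))"
      unfolding mvec_def hom_part_sum
    proof (intro sum.cong refl)
      fix k assume "k \<in> {..<c}"
      then show "hom_part (e - s l) (M l k * w k) = M l k * hom_part (e - s' k) (w k)"
        using hom_part_mult[OF hmat_entry[OF M True, of k], of "w k" "e - s l"] w(1)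
        by (simp add: vecs_def)
    qed
    finally show ?thesis by (simp add: mvec_def w'_def)
  next
    case False
    then show ?thesis using hmat_outside[OF M, of l] w(2) by (simp add: mvec_def)
  qed
  ultimately show thesis using that by blast
qed

text \<open>The columns of \<open>P\<close> are lifted separately, to homogeneous preimages; columns
  beyond \<open>a\<close> are filled with zeros.\<close>

lemma lift_matrix:
  assumes M: "hmat n r s c s' M" and P: "hmat n r s a s'' P"
    and im: "\<And>k. k < a \<Longrightarrow> (\<lambda>l. P l k) \<in> mvec c M ` vecs n c"
  obtains X where "hmat n c s' a s'' X" "mmul c M X = P"
proof -
  have "\<exists>w. hvec n c s' (s'' k) w \<and> (\<lambda>l. P l k) = mvec c M w" if "k < a" for k
    using homogeneous_preimage[OF M hmat_column[OF P that]] im[OF that] by blast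
  then obtain x where x: "\<And>k. k < a \<Longrightarrow> hvec n c s' (s'' k) (x k) \<and> (\<lambda>l. P l k) = mvec c M (x k)"
    by metis
  define X where "X = (\<lambda>l k. if k < a then x k l else 0)"
  have "hmat n c s' a s'' X"
    using x by (intro hmatI) (auto simp: X_def hvec_def split: if_splits, (metis singletonD)+)
  moreover have "(\<lambda>l. mmul c M X l k) = (\<lambda>l. P l k)" for k
    using x hmat_outside[OF P, of _ k] by (cases "k < a") (simp_all add: mmul_column X_def mvec_def)
  then have "mmul c M X = P" by (simp add: fun_eq_iff)
  ultimately show thesis using that by blast
qed

text \<open>With \<open>\<psi>\<close> concentrated in degree 0 this produces lifts of maps to chain maps; for a
  chain map \<open>\<psi>\<close>, and \<open>- A\<close> in place of \<open>A\<close>, it produces null homotopies.\<close>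

lemma lift_sequence:
  fixes A B \<psi> :: "nat \<Rightarrow> nat \<Rightarrow> nat \<Rightarrow> 'k::field mpol"
  assumes A: "\<And>i. hmat n (a i) (\<sigma> i) (a (Suc i)) (\<sigma> (Suc i)) (A i)"
    and AA: "\<And>i. mmul (a (Suc i)) (A i) (A (Suc i)) = 0"
    and B: "\<And>i. hmat n (b i) (\<tau> i) (b (Suc i)) (\<tau> (Suc i)) (B i)"
    and exact: "\<And>i v. v \<in> vecs n (b (Suc i)) \<Longrightarrow> mvec (b (Suc i)) (B i) v = 0 \<Longrightarrow>
      v \<in> mvec (b (Suc (Suc i))) (B (Suc i)) ` vecs n (b (Suc (Suc i)))"
    and \<psi>: "\<And>i. hmat n (b i) (\<tau> i) (a i) (\<sigma> i) (\<psi> i)"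
    and \<psi>0: "\<And>k. k < a 0 \<Longrightarrow> (\<lambda>l. \<psi> 0 l k) \<in> mvec (b 1) (B 0) ` vecs n (b 1)"
    and B\<psi>: "\<And>i. mmul (b (Suc i)) (B i) (\<psi> (Suc i)) = - mmul (a i) (\<psi> i) (A i)"
  obtains X where "\<And>i. hmat n (b (Suc i)) (\<tau> (Suc i)) (a i) (\<sigma> i) (X i)"
    "mmul (b 1) (B 0) (X 0) = \<psi> 0"
    "\<And>i. mmul (b (Suc (Suc i))) (B (Suc i)) (X (Suc i)) = \<psi> (Suc i) + mmul (a i) (X i) (A i)"
proof -
  \<comment> \<open>The last clause of the invariant says that \<open>B i\<close> times
    \<open>X\<close> agrees with \<open>\<psi> i\<close> after composition with \<open>A i\<close>.
    Together with \<open>B\<psi>\<close> this makes the next right-hand side a cycle, at the start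
    and later alike.\<close>
  let ?P = "\<lambda>i X. hmat n (b (Suc i)) (\<tau> (Suc i)) (a i) (\<sigma> i) X \<and>
    (i = 0 \<longrightarrow> mmul (b 1) (B 0) X = \<psi> 0) \<and>
    mmul (a i) (mmul (b (Suc i)) (B i) X) (A i) = mmul (a i) (\<psi> i) (A i)"
  let ?Q = "\<lambda>i X Y. mmul (b (Suc (Suc i))) (B (Suc i)) Y = \<psi> (Suc i) + mmul (a i) X (A i)"
  have 0: "\<exists>X. ?P 0 X"
  proof -
    obtain X where "hmat n (b 1) (\<tau> 1) (a 0) (\<sigma> 0) X" "mmul (b 1) (B 0) X = \<psi> 0"
      using lift_matrix[OF B[of 0] \<psi>[of 0]] \<psi>0 by (metis One_nat_def)
    then show ?thesis by auto
  qed
  have S: "\<exists>Y. ?P (Suc i) Y \<and> ?Q i X Y" if X: "?P i X" for i X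
  proof -
    let ?R = "\<psi> (Suc i) + mmul (a i) X (A i)"
    have R: "hmat n (b (Suc i)) (\<tau> (Suc i)) (a (Suc i)) (\<sigma> (Suc i)) ?R"
      using X by (intro hmat_add hmat_mmul[OF _ A] \<psi>) auto
    have "mmul (b (Suc i)) (B i) ?R = 0"
      using X B\<psi>[of i] by (simp add: mmul_add_right mmul_assoc fun_eq_iff fun_Compl_def)
    then have "mvec (b (Suc i)) (B i) (\<lambda>l. ?R l k) = 0" for k
      by (simp add: fun_eq_iff mmul_def mvec_def)
    then obtain Y where Y: "hmat n (b (Suc (Suc i))) (\<tau> (Suc (Suc i))) (a (Suc i)) (\<sigma> (Suc i)) Y"
        "mmul (b (Suc (Suc i))) (B (Suc i)) Y = ?R"
      using lift_matrix[OF B R] exact[OF hvec_vecs[OF hmat_column[OF R]]] by metis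
    have "mmul (a (Suc i)) ?R (A (Suc i)) = mmul (a (Suc i)) (\<psi> (Suc i)) (A (Suc i))"
      by (simp add: mmul_add_left mmul_assoc AA)
    then show ?thesis using Y by auto
  qed
  obtain X where X: "\<And>i. ?P i (X i) \<and> ?Q i (X i) (X (Suc i))"
    using dependent_nat_choice[of ?P ?Q, OF 0 S] by blast
  show thesis by (rule that[of X]) (use X in auto)
qed

section \<open>Dimensions of subquotients\<close>

text \<open>If \<open>f x\<close> depended on the images of \<open>e\<close> and on
  \<open>b'\<close>, then for some \<open>y\<close> in the span of \<open>e\<close> the vector
  \<open>x - y\<close> would be mapped into the span of \<open>b'\<close>, hence lie in the span of
  \<open>b\<close>, and \<open>x\<close> would depend on \<open>e\<close> and \<open>b\<close>. So
  the vectors of \<open>e\<close> can be added one at a time.\<close>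

lemma (in vector_space) independent_image_mod_subspace:
  assumes f: "Vector_Spaces.linear scale scale f" and e: "finite e" "e \<inter> b = {}" "independent (e \<union> b)"
    and b': "independent b'" "finite b'"
    and pre: "\<And>x. x \<in> span (e \<union> b) \<Longrightarrow> f x \<in> span b' \<Longrightarrow> x \<in> span b"
  shows "independent (f ` e \<union> b') \<and> card (f ` e \<union> b') = card e + card b'"
  using e pre
proof (induction e rule: finite_induct)
  case empty
  then show ?case using b' by simp
next
  case (insert x e)
  interpret f: Vector_Spaces.linear scale scale f by fact
  have sub: "span (e \<union> b) \<subseteq> span (insert x e \<union> b)" by (rule span_mono) auto
  have IH: "independent (f ` e \<union> b') \<and> card (f ` e \<union> b') = card e + card b'"
    using insert.prems sub independent_mono[OF insert.prems(2), of "e \<union> b"] by (intro insert.IH) auto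
  have fx: "f x \<notin> span (f ` e \<union> b')"
  proof
    assume "f x \<in> span (f ` e \<union> b')"
    then obtain y w where y: "y \<in> span e" and w: "w \<in> span b'" "f x = f y + w"
      unfolding span_Un f.span_image by blast
    have ye: "y \<in> span (e \<union> b)" using y span_mono[of e "e \<union> b"] by auto
    have "x - y \<in> span (insert x e \<union> b)"
      using subsetD[OF sub ye] by (intro span_diff) (auto intro: span_base)
    moreover have "f (x - y) \<in> span b'" using w by (simp add: f.diff)
    ultimately have "x - y \<in> span b" using insert.prems by blast
    then have "(x - y) + y \<in> span (e \<union> b)"
      using ye span_add span_mono[of b "e \<union> b"] by blast
    then have "x \<in> span (e \<union> b)" by simp
    moreover have "(insert x e \<union> b) - {x} = e \<union> b" using insert.hyps insert.prems by auto
    ultimately show False using insert.prems(2) unfolding dependent_def by (metis UnI1 insertI1)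
  qed
  then have fx': "f x \<notin> f ` e \<union> b'" by (rule contrapos_nn[OF _ span_base])
  have "f ` insert x e \<union> b' = insert (f x) (f ` e \<union> b')" by simp
  then show ?case
    using IH insert.hyps b'(2) fx' independent_insertI[OF fx] by simp
qed

text \<open>A complement of \<open>B\<close> in \<open>Z\<close> is mapped injectively into
  \<open>Z'\<close> modulo \<open>B'\<close>. It is spanned by \<open>c - b\<close>, where
  \<open>c\<close> is a basis of \<open>Z\<close> extending a basis \<open>b\<close> of
  \<open>B\<close>. With cycles and boundaries this turns injectivity on homology into an
  inequality.\<close>

lemma (in vector_space) dim_quotient_mono:
  assumes f: "Vector_Spaces.linear scale scale f"
    and sub: "subspace Z" "subspace B" "subspace B'"
    and Z: "B \<subseteq> Z" "Z \<subseteq> span E" "finite E" and Z': "B' \<subseteq> Z'" "Z' \<subseteq> span E'" "finite E'"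
    and fZ: "f ` Z \<subseteq> Z'" and pre: "\<And>z. z \<in> Z \<Longrightarrow> f z \<in> B' \<Longrightarrow> z \<in> B"
  shows "dim Z - dim B \<le> dim Z' - dim B'"
proof -
  obtain b where b: "b \<subseteq> B" "independent b" "B \<subseteq> span b" "card b = dim B"
    by (rule basis_exists)
  obtain c where c: "b \<subseteq> c" "c \<subseteq> Z" "independent c" "Z \<subseteq> span c"
    using maximal_independent_subset_extend[OF subset_trans[OF b(1) Z(1)] b(2)] by metis
  obtain b' where b': "b' \<subseteq> B'" "independent b'" "B' \<subseteq> span b'" "card b' = dim B'"
    by (rule basis_exists)
  have finc: "finite c" using independent_span_bound[OF Z(3) c(3)] c(2) Z(2) by auto
  have finb': "finite b'" using independent_span_bound[OF Z'(3) b'(2)] b'(1) Z' by auto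
  have dimZ: "dim Z = card c" using basis_card_eq_dim[OF c(2,4,3)] by simp
  have spans: "span c = Z" "span b = B" "span b' = B'"
    using span_subspace[OF c(2,4) sub(1)] span_subspace[OF b(1,3) sub(2)]
      span_subspace[OF b'(1,3) sub(3)] by auto
  have cb: "(c - b) \<union> b = c" using c(1) by auto
  have ind: "independent (f ` (c - b) \<union> b') \<and> card (f ` (c - b) \<union> b') = card (c - b) + card b'"
  proof (rule independent_image_mod_subspace[OF f])
    show "independent ((c - b) \<union> b)" unfolding cb by (rule c)
    show "x \<in> span b" if "x \<in> span ((c - b) \<union> b)" "f x \<in> span b'" for x
      using that pre unfolding cb spans by blast
  qed (use finc finb' b'(2) in auto)
  have "f ` (c - b) \<union> b' \<subseteq> Z'" using fZ c(2) b'(1) Z'(1) by auto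
  then obtain d where d: "f ` (c - b) \<union> b' \<subseteq> d" "d \<subseteq> Z'" "independent d" "Z' \<subseteq> span d"
    using maximal_independent_subset_extend ind by metis
  have "finite d" using independent_span_bound[OF Z'(3) d(3)] d(2) Z' by auto
  then have "card (f ` (c - b) \<union> b') \<le> dim Z'"
    using card_mono d(1) basis_card_eq_dim[OF d(2,4,3)] by metis
  then show ?thesis
    using ind dimZ b(4) b'(4) card_Diff_subset[OF finite_subset[OF c(1) finc] c(1)] by simp
qed

section \<open>Augmented resolutions\<close>

text \<open>The augmentation \<open>F\<^sub>0 \<rightarrow> S\<close> becomes the matrix \<open>D 0\<close>, so that the module of index
  \<open>i\<close> in a graded free resolution has index \<open>Suc i\<close> here; entries outside the relevant range
  are required to vanish.\<close>

definition aug_resolution :: "nat \<Rightarrow> 'k::field mpol set \<Rightarrow> (nat \<Rightarrow> nat) \<Rightarrow> (nat \<Rightarrow> nat \<Rightarrow> int) \<Rightarrow>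
    (nat \<Rightarrow> nat \<Rightarrow> nat \<Rightarrow> 'k mpol) \<Rightarrow> bool" where
  "aug_resolution n I r s D \<longleftrightarrow> I \<subseteq> carrier (poly_ring n) \<and> r 0 = 1 \<and> s 0 = (\<lambda>_. 0) \<and>
     (\<forall>i. hmat n (r i) (s i) (r (Suc i)) (s (Suc i)) (D i)) \<and>
     mvec (r 1) (D 0) ` vecs n (r 1) = {v \<in> vecs n 1. v 0 \<in> I} \<and>
     (\<forall>i. {v \<in> vecs n (r (Suc i)). mvec (r (Suc i)) (D i) v = 0} =
        mvec (r (Suc (Suc i))) (D (Suc i)) ` vecs n (r (Suc (Suc i))))"

lemma free_mod_eq_vecs: "free_mod n F i = vecs n (rank F i)"
  by (simp add: free_mod_def vecs_def)

definition aug_rank :: "'k::field free_complex \<Rightarrow> nat \<Rightarrow> nat" where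
  "aug_rank F i = (case i of 0 \<Rightarrow> 1 | Suc m \<Rightarrow> rank F m)"

definition aug_shift :: "'k::field free_complex \<Rightarrow> nat \<Rightarrow> nat \<Rightarrow> int" where
  "aug_shift F i = (case i of 0 \<Rightarrow> (\<lambda>_. 0) | Suc m \<Rightarrow> shift F m)"

text \<open>A graded free resolution leaves the entries of \<open>aug\<close> and
  \<open>dmat\<close> beyond the ranks unspecified; they are replaced by zero, as
  \<open>hmat\<close> demands.\<close>

definition aug_mat :: "'k::field free_complex \<Rightarrow> nat \<Rightarrow> nat \<Rightarrow> nat \<Rightarrow> 'k mpol" where
  "aug_mat F i = (\<lambda>l k. if l < aug_rank F i \<and> k < aug_rank F (Suc i)
     then (case i of 0 \<Rightarrow> aug F k | Suc m \<Rightarrow> dmat F m l k) else 0)"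

lemma aug_simps [simp]:
  "aug_rank F 0 = 1" "aug_rank F (Suc i) = rank F i"
  "aug_shift F 0 = (\<lambda>_. 0)" "aug_shift F (Suc i) = shift F i"
  by (simp_all add: aug_rank_def aug_shift_def)

lemma diff_map_eq_mvec: "diff_map F i v = mvec (rank F (Suc i)) (aug_mat F (Suc i)) v"
  by (auto simp: diff_map_def mvec_def aug_mat_def fun_eq_iff mult.commute intro!: sum.cong)

lemma aug_map_eq_mvec: "mvec (rank F 0) (aug_mat F 0) v = (\<lambda>l. if l = 0 then aug_map F v else 0)"
  by (auto simp: aug_map_def mvec_def aug_mat_def fun_eq_iff mult.commute intro!: sum.cong)

lemma aug_resolution_aug:
  assumes "graded_free_resolution n I F"
  shows "aug_resolution n I (aug_rank F) (aug_shift F) (aug_mat F)"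
proof -
  have hm: "hmat n (aug_rank F i) (aug_shift F i) (aug_rank F (Suc i)) (aug_shift F (Suc i)) (aug_mat F i)"
    for i
    using assms by (intro hmatI) (cases i; auto simp: aug_mat_def graded_free_resolution_def)+
  have im: "aug_map F ` vecs n (rank F 0) = I"
    using assms by (simp add: graded_free_resolution_def free_mod_eq_vecs)
  have I: "I \<subseteq> carrier (poly_ring n)"
  proof
    fix p assume "p \<in> I"
    then obtain w where w: "w \<in> vecs n (rank F 0)" "p = aug_map F w" using im by blast
    then show "p \<in> carrier (poly_ring n)"
      using mvec_vecs[OF hm[of 0], of w] by (simp add: aug_map_eq_mvec vecs_def)
  qed
  have "mvec (rank F 0) (aug_mat F 0) ` vecs n (rank F 0) = {v \<in> vecs n 1. v 0 \<in> I}"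
  proof (intro equalityI subsetI)
    fix v assume "v \<in> mvec (rank F 0) (aug_mat F 0) ` vecs n (rank F 0)"
    then obtain w where w: "w \<in> vecs n (rank F 0)" "v = mvec (rank F 0) (aug_mat F 0) w" by blast
    then show "v \<in> {v \<in> vecs n 1. v 0 \<in> I}"
      using mvec_vecs[OF hm[of 0]] im by (auto simp: aug_map_eq_mvec)
  next
    fix v assume v: "v \<in> {v \<in> vecs n 1. v 0 \<in> I}"
    then obtain w where w: "w \<in> vecs n (rank F 0)" "v 0 = aug_map F w" using im by blast
    then have "v = mvec (rank F 0) (aug_mat F 0) w"
      using v by (auto simp: aug_map_eq_mvec vecs_def fun_eq_iff)
    then show "v \<in> mvec (rank F 0) (aug_mat F 0) ` vecs n (rank F 0)" using w by blast
  qed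
  moreover have "mvec (rank F 0) (aug_mat F 0) v = 0 \<longleftrightarrow> aug_map F v = 0" for v
    by (auto simp: aug_map_eq_mvec fun_eq_iff)
  then have "{v \<in> vecs n (aug_rank F (Suc i)). mvec (aug_rank F (Suc i)) (aug_mat F i) v = 0} =
        mvec (aug_rank F (Suc (Suc i))) (aug_mat F (Suc i)) ` vecs n (aug_rank F (Suc (Suc i)))" for i
    using assms by (cases i)
      (simp_all add: graded_free_resolution_def free_mod_eq_vecs flip: diff_map_eq_mvec)
  ultimately show ?thesis
    unfolding aug_resolution_def using hm I by simp
qed

lemma graded_free_resolution_of_aug:
  assumes "aug_resolution n I r s D"
  defines "F \<equiv> \<lparr>rank = (\<lambda>i. r (Suc i)), shift = (\<lambda>i. s (Suc i)), aug = D 0 0, dmat = (\<lambda>i. D (Suc i))\<rparr>"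
  shows "graded_free_resolution n I F"
proof -
  have I: "I \<subseteq> carrier (poly_ring n)" and r0: "r 0 = 1" "s 0 = (\<lambda>_. 0)"
    and hm: "\<And>i. hmat n (r i) (s i) (r (Suc i)) (s (Suc i)) (D i)"
    and im: "mvec (r 1) (D 0) ` vecs n (r 1) = {v \<in> vecs n 1. v 0 \<in> I}"
    and ex: "\<And>i. {v \<in> vecs n (r (Suc i)). mvec (r (Suc i)) (D i) v = 0} =
        mvec (r (Suc (Suc i))) (D (Suc i)) ` vecs n (r (Suc (Suc i)))"
    using assms unfolding aug_resolution_def by auto
  have rank: "aug_rank F = r" "aug_shift F = s"
    using r0 by (auto simp: F_def aug_rank_def aug_shift_def fun_eq_iff split: nat.splits)
  have mat: "aug_mat F = D"
  proof (intro ext)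
    fix i l k
    show "aug_mat F i l k = D i l k"
      using hmat_outside[OF hm[of i], of l k] r0 unfolding aug_mat_def rank
      by (auto simp: F_def split: nat.splits)
  qed
  have am: "mvec (r 1) (D 0) v = (\<lambda>l. if l = 0 then aug_map F v else 0)" for v
    using aug_map_eq_mvec[of F v] unfolding mat by (simp add: F_def)
  have dm: "diff_map F i v = mvec (r (Suc (Suc i))) (D (Suc i)) v" for i v
    using diff_map_eq_mvec[of F i v] unfolding mat by (simp add: F_def)
  have "aug_map F ` vecs n (r 1) = I"
  proof (intro equalityI subsetI)
    fix p assume "p \<in> aug_map F ` vecs n (r 1)"
    then obtain w where "w \<in> vecs n (r 1)" "p = aug_map F w" by blast
    moreover from this have "mvec (r 1) (D 0) w \<in> {v \<in> vecs n 1. v 0 \<in> I}" using im by blast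
    ultimately show "p \<in> I" using am[of w] by auto
  next
    fix p assume "p \<in> I"
    then have "(\<lambda>l. if l = 0 then p else 0) \<in> {v \<in> vecs n 1. v 0 \<in> I}"
      using I by (auto simp: vecs_def)
    then obtain w where "w \<in> vecs n (r 1)" "(\<lambda>l. if l = 0 then p else 0) = mvec (r 1) (D 0) w"
      using im by blast
    then show "p \<in> aug_map F ` vecs n (r 1)" unfolding am by (metis imageI)
  qed
  moreover have "mvec (r 1) (D 0) v = 0 \<longleftrightarrow> aug_map F v = 0" for v
    unfolding am by (auto simp: fun_eq_iff)
  ultimately show ?thesis
    using hmat_entry[OF hm[of 0]] hmat_entry[OF hm[of "Suc i" for i]] ex[of 0] ex[of "Suc i" for i] r0
    unfolding graded_free_resolution_def free_mod_eq_vecs dm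
    by (simp add: F_def)
qed

section \<open>Comparison of resolutions\<close>

locale aug_res =
  fixes n :: nat and I :: "'k::field mpol set" and r s D
  assumes res: "aug_resolution n I r s D"
begin

lemma r0: "r 0 = 1" and s0: "s 0 = (\<lambda>_. 0)" and I_carrier: "I \<subseteq> carrier (poly_ring n)"
  and hmat_D: "hmat n (r i) (s i) (r (Suc i)) (s (Suc i)) (D i)"
  and image_D0: "mvec (r 1) (D 0) ` vecs n (r 1) = {v \<in> vecs n 1. v 0 \<in> I}"
  and kernel_D: "{v \<in> vecs n (r (Suc i)). mvec (r (Suc i)) (D i) v = 0} =
        mvec (r (Suc (Suc i))) (D (Suc i)) ` vecs n (r (Suc (Suc i)))"
  using res unfolding aug_resolution_def by blast+

text \<open>Exactness speaks of vectors. Evaluated at the unit vectors, that is, at the columns of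
  \<open>idm\<close>, it gives the matrix identity.\<close>

lemma D_D: "mmul (r (Suc i)) (D i) (D (Suc i)) = 0"
proof -
  have unit: "(\<lambda>j. idm (r i) j k) \<in> vecs n (r i)" if "k < r i" for i k
    using hvec_vecs[OF hmat_column[OF hmat_idm[of n "r i" "\<lambda>_. 0"] that]] .
  have "mvec (r (Suc i)) (D i) (\<lambda>l. D (Suc i) l k) = 0" for k
  proof (cases "k < r (Suc (Suc i))")
    case True
    have "(\<lambda>l. D (Suc i) l k) = mvec (r (Suc (Suc i))) (D (Suc i)) (\<lambda>j. idm (r (Suc (Suc i))) j k)"
      unfolding mmul_column[symmetric] mmul_idm_right[OF hmat_D] ..
    then show ?thesis using kernel_D[of i] unit[OF True] by blast
  next
    case False
    then have "D (Suc i) l k = 0" for l using hmat_outside[OF hmat_D[of "Suc i"], of l k] by simp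
    then show ?thesis by (simp add: mvec_def zero_fun_def)
  qed
  then show ?thesis by (simp add: fun_eq_iff mmul_def mvec_def)
qed

lemma exact_D: "v \<in> vecs n (r (Suc i)) \<Longrightarrow> mvec (r (Suc i)) (D i) v = 0 \<Longrightarrow>
    v \<in> mvec (r (Suc (Suc i))) (D (Suc i)) ` vecs n (r (Suc (Suc i)))"
  using kernel_D[of i] by blast

lemma column_D0:
  assumes "k < r 1" shows "(\<lambda>l. D 0 l k) \<in> vecs n 1" "D 0 0 k \<in> I"
proof -
  have "(\<lambda>j. idm (r 1) j k) \<in> vecs n (r 1)"
    using hvec_vecs[OF hmat_column[OF hmat_idm[of n "r 1" "\<lambda>_. 0"] assms]] .
  moreover have "(\<lambda>l. D 0 l k) = mvec (r 1) (D 0) (\<lambda>j. idm (r 1) j k)"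
    unfolding mmul_column[symmetric] using mmul_idm_right[OF hmat_D[of 0]] by simp
  ultimately show "(\<lambda>l. D 0 l k) \<in> vecs n 1" "D 0 0 k \<in> I" using image_D0 by force+
qed

end

text \<open>Lifts the identity of S at index 0: the columns of \<open>D 0\<close> lie in I, which is
  the image of \<open>D' 0\<close>, so \<open>f 0\<close> exists, and exactness of the second
  complex supplies the rest.\<close>

lemma chain_map_exists:
  assumes "aug_resolution n I r s D" "aug_resolution n I r' s' D'"
  obtains f where "\<And>i. hmat n (r' (Suc i)) (s' (Suc i)) (r (Suc i)) (s (Suc i)) (f i)"
    "mmul (r' 1) (D' 0) (f 0) = D 0"
    "\<And>i. mmul (r' (Suc (Suc i))) (D' (Suc i)) (f (Suc i)) = mmul (r (Suc i)) (f i) (D (Suc i))"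
proof -
  interpret F: aug_res n I r s D by unfold_locales fact
  interpret G: aug_res n I r' s' D' by unfold_locales fact
  let ?\<psi> = "\<lambda>i :: nat. if i = 0 then D 0 else 0"
  obtain f where f: "\<And>i. hmat n (r' (Suc i)) (s' (Suc i)) (r (Suc i)) (s (Suc i)) (f i)"
    "mmul (r' 1) (D' 0) (f 0) = ?\<psi> 0"
    "\<And>i. mmul (r' (Suc (Suc i))) (D' (Suc i)) (f (Suc i)) = ?\<psi> (Suc i) + mmul (r (Suc i)) (f i) (D (Suc i))"
  proof (rule lift_sequence[where a = "\<lambda>i. r (Suc i)" and \<sigma> = "\<lambda>i. s (Suc i)" and
        A = "\<lambda>i. D (Suc i)" and b = r' and \<tau> = s' and B = D' and \<psi> = ?\<psi> and n = n])
    show "hmat n (r' i) (s' i) (r (Suc i)) (s (Suc i)) (if i = 0 then D 0 else 0)" for i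
      using F.hmat_D[of 0] F.r0 G.r0 F.s0 G.s0 by auto
    show "mmul (r' (Suc i)) (D' i) (if Suc i = 0 then D 0 else 0) =
        - mmul (r (Suc i)) (if i = 0 then D 0 else 0) (D (Suc i))" for i
      using F.D_D[of 0] by auto
    show "(\<lambda>l. (if (0::nat) = 0 then D 0 else 0) l k) \<in> mvec (r' 1) (D' 0) ` vecs n (r' 1)"
      if "k < r (Suc 0)" for k
      using F.column_D0[of k] that by (simp add: G.image_D0[unfolded One_nat_def])
  qed (rule F.hmat_D F.D_D G.hmat_D G.exact_D | assumption | blast)+
  show thesis by (rule that[of f]) (use f in simp_all)
qed

text \<open>The columns of \<open>\<psi> 0\<close> lie in the kernel of \<open>D 0\<close>, hence in
  the image of \<open>D 1\<close>, and this starts the homotopy. Taking \<open>- D\<close> as the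
  source differential turns the sum delivered by \<open>lift_sequence\<close> into the difference
  wanted here.\<close>

lemma homotopy_exists:
  assumes "aug_resolution n I r s D"
    and \<psi>: "\<And>i. hmat n (r (Suc i)) (s (Suc i)) (r (Suc i)) (s (Suc i)) (\<psi> i)"
    and \<psi>0: "mmul (r 1) (D 0) (\<psi> 0) = 0"
    and D\<psi>: "\<And>i. mmul (r (Suc (Suc i))) (D (Suc i)) (\<psi> (Suc i)) = mmul (r (Suc i)) (\<psi> i) (D (Suc i))"
  obtains h where "\<And>i. hmat n (r (Suc (Suc i))) (s (Suc (Suc i))) (r (Suc i)) (s (Suc i)) (h i)"
    "mmul (r (Suc (Suc 0))) (D (Suc 0)) (h 0) = \<psi> 0"
    "\<And>i. mmul (r (Suc (Suc (Suc i)))) (D (Suc (Suc i))) (h (Suc i)) =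
       \<psi> (Suc i) - mmul (r (Suc i)) (h i) (D (Suc i))"
proof -
  interpret F: aug_res n I r s D by unfold_locales fact
  obtain h where h: "\<And>i. hmat n (r (Suc (Suc i))) (s (Suc (Suc i))) (r (Suc i)) (s (Suc i)) (h i)"
    "mmul (r (Suc 1)) (D (Suc 0)) (h 0) = \<psi> 0"
    "\<And>i. mmul (r (Suc (Suc (Suc i)))) (D (Suc (Suc i))) (h (Suc i)) =
       \<psi> (Suc i) + mmul (r (Suc i)) (h i) (- D (Suc i))"
  proof (rule lift_sequence[where a = "\<lambda>i. r (Suc i)" and \<sigma> = "\<lambda>i. s (Suc i)" and
        A = "\<lambda>i. - D (Suc i)" and b = "\<lambda>i. r (Suc i)" and \<tau> = "\<lambda>i. s (Suc i)" and
        B = "\<lambda>i. D (Suc i)" and \<psi> = \<psi> and n = n])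
    show "(\<lambda>l. \<psi> 0 l k) \<in> mvec (r (Suc 1)) (D (Suc 0)) ` vecs n (r (Suc 1))" if "k < r (Suc 0)" for k
    proof -
      have "mvec (r (Suc 0)) (D 0) (\<lambda>l. \<psi> 0 l k) = 0"
        using \<psi>0 by (simp flip: mmul_column add: zero_fun_def)
      then show ?thesis
        using F.exact_D[OF hvec_vecs[OF hmat_column[OF \<psi> that]]] by simp
    qed
    show "mmul (r (Suc (Suc i))) (D (Suc i)) (\<psi> (Suc i)) = - mmul (r (Suc i)) (\<psi> i) (- D (Suc i))" for i
      by (simp add: mmul_uminus_right D\<psi>)
  qed (simp_all add: mmul_uminus_left mmul_uminus_right F.D_D \<psi> F.hmat_D hmat_uminus F.exact_D, blast)
  show thesis by (rule that[of h]) (use h in \<open>simp_all add: mmul_uminus_right\<close>)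
qed

section \<open>Independence of Tor from the resolution\<close>

text \<open>Reduction modulo the ideal of the variables: the matrix of the map after tensoring with
  K.\<close>

definition const_mat :: "(nat \<Rightarrow> nat \<Rightarrow> 'k::field mpol) \<Rightarrow> nat \<Rightarrow> nat \<Rightarrow> 'k" where
  "const_mat M = (\<lambda>l k. lookup (M l k) 0)"

lemma const_mat_mmul: "const_mat (mmul c A B) = mmul c (const_mat A) (const_mat B)"
  by (simp add: const_mat_def mmul_def fun_eq_iff lookup_sum lookup_mult_0)

lemma const_mat_diff: "const_mat (A - B) = const_mat A - const_mat B"
  by (simp add: const_mat_def fun_eq_iff lookup_minus)

lemma const_mat_zero [simp]: "const_mat 0 = 0"
  by (simp add: const_mat_def fun_eq_iff)

lemma const_mat_idm: "const_mat (idm c) = idm c"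
  by (auto simp: const_mat_def idm_def fun_eq_iff)

definition kspace :: "nat \<Rightarrow> (nat \<Rightarrow> int) \<Rightarrow> int \<Rightarrow> (nat \<Rightarrow> 'k::field) set" where
  "kspace r s j = {c. \<forall>k. c k \<noteq> 0 \<longrightarrow> k < r \<and> s k = j}"

text \<open>Nonzero constants have degree 0, so an entry between basis elements of different degrees
  has no constant term. This serves twice: reduced matrices preserve degrees, and mapping cones stay
  minimal.\<close>

lemma const_mat_nonzero:
  assumes "hmat n r s c s' M" "const_mat M l k \<noteq> 0"
  shows "l < r \<and> k < c \<and> s' k = s l"
proof (rule ccontr)
  assume *: "\<not> ?thesis"
  show False
  proof (cases "l < r \<and> k < c")
    case True
    then show False
      using homog_pos_lookup_0[OF hmat_entry[OF assms(1)], of l k] assms(2) * by (simp add: const_mat_def)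
  next
    case False
    then show False using hmat_outside[OF assms(1), of l k] assms(2) by (simp add: const_mat_def)
  qed
qed

lemma const_mat_kspace:
  assumes M: "hmat n r s c s' M" and z: "z \<in> kspace c s' j"
  shows "mvec c (const_mat M) z \<in> kspace r s j"
proof -
  have "l < r \<and> s l = j" if nz: "mvec c (const_mat M) z l \<noteq> 0" for l
  proof -
    obtain k where "k < c" "const_mat M l k * z k \<noteq> 0"
      using sum.not_neutral_contains_not_neutral[OF nz[unfolded mvec_def]] by blast
    then show ?thesis using const_mat_nonzero[OF M, of l k] z by (auto simp: kspace_def)
  qed
  then show ?thesis by (simp add: kspace_def)
qed

interpretation K: vector_space "\<lambda>(a::'k::field) (c :: nat \<Rightarrow> 'k) k. a * c k"
  by (rule vector_space_K)

lemma linear_mvec: "Vector_Spaces.linear (\<lambda>(a::'k::field) c k. a * c k) (\<lambda>a c k. a * c k) (mvec c M)"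
  unfolding Vector_Spaces.linear_iff
  by (simp add: vector_space_K mvec_add) (simp add: mvec_def sum_distrib_left mult.left_commute)

lemma kspace_subspace: "K.subspace (kspace r s j)"
  unfolding K.subspace_def by (auto simp: kspace_def zero_fun_def) (metis add_0)+

lemma sum_fun_apply: "(\<Sum>a\<in>A. f a) x = (\<Sum>a\<in>A. f a x)"
  for f :: "'b \<Rightarrow> 'c \<Rightarrow> 'd::comm_monoid_add"
  by (induction A rule: infinite_finite_induct) simp_all

lemma kspace_eq_span:
  "kspace r s j = K.span ((\<lambda>k l. if l = k then 1 else 0) ` {k. k < r \<and> s k = j})"
proof (intro equalityI subsetI)
  fix c :: "nat \<Rightarrow> 'a" assume c: "c \<in> kspace r s j"
  let ?A = "{k. k < r \<and> s k = j}"
  have "c = (\<Sum>k\<in>?A. (\<lambda>l. c k * (if l = k then 1 else 0)))"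
  proof
    fix l
    have "(\<Sum>k\<in>?A. (\<lambda>l. c k * (if l = k then 1 else 0))) l = (\<Sum>k\<in>?A. if k = l then c k else 0)"
      unfolding sum_fun_apply by (intro sum.cong) auto
    also have "\<dots> = c l" using c by (auto simp: kspace_def)
    finally show "c l = (\<Sum>k\<in>?A. (\<lambda>l. c k * (if l = k then 1 else 0))) l" ..
  qed
  also have "\<dots> \<in> K.span ((\<lambda>k l. if l = k then 1 else 0) ` ?A)"
    by (intro K.span_sum K.span_scale K.span_base) auto
  finally show "c \<in> K.span ((\<lambda>k l. if l = k then 1 else 0) ` ?A)" .
next
  fix c :: "nat \<Rightarrow> 'a" assume "c \<in> K.span ((\<lambda>k l. if l = k then 1 else 0) ` {k. k < r \<and> s k = j})"
  moreover have "(\<lambda>k l. if l = k then 1 else 0) ` {k. k < r \<and> s k = j} \<subseteq> (kspace r s j :: (nat \<Rightarrow> 'a) set)"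
    by (auto simp: kspace_def split: if_splits)
  ultimately show "c \<in> kspace r s j"
    using K.span_minimal[OF _ kspace_subspace] by blast
qed

lemma dim_kspace: "dim_K (kspace r s j :: (nat \<Rightarrow> 'k::field) set) = card {k. k < r \<and> s k = j}"
proof -
  let ?A = "{k. k < r \<and> s k = j}" and ?e = "\<lambda>k l. if l = k then 1 else (0::'k)"
  have inj: "inj_on ?e ?A" by (rule inj_onI) (metis zero_neq_one)
  have "K.independent (?e ` ?A)"
  proof (rule K.independent_if_scalars_zero)
    fix u x assume u: "(\<Sum>x\<in>?e ` ?A. (\<lambda>k. u x * x k)) = 0" and x: "x \<in> ?e ` ?A"
    then obtain k where k: "k \<in> ?A" "x = ?e k" by blast
    have "0 = (\<Sum>i\<in>?A. (\<lambda>l. u (?e i) * ?e i l)) k"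
      using fun_cong[OF u, of k] by (simp add: sum.reindex[OF inj] o_def)
    also have "\<dots> = (\<Sum>i\<in>?A. if i = k then u (?e k) else 0)"
      unfolding sum_fun_apply by (intro sum.cong) auto
    also have "\<dots> = u x" using k by simp
    finally show "u x = 0" ..
  qed simp
  then show ?thesis
    unfolding dim_K_def kspace_eq_span K.dim_span by (simp add: K.dim_eq_card_independent card_image[OF inj])
qed

lemma K_diff_eq: "K_diff F i c = mvec (rank F (Suc i)) (const_mat (aug_mat F (Suc i))) c"
  by (auto simp: K_diff_def mvec_def aug_mat_def const_mat_def fun_eq_iff mult.commute intro!: sum.cong)

lemma K_mod_eq: "K_mod F i j = kspace (rank F i) (shift F i) j"
  by (simp add: K_mod_def kspace_def)

lemma K_cycles_iff: "z \<in> K_cycles F i j \<longleftrightarrow>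
    z \<in> kspace (rank F i) (shift F i) j \<and> (\<forall>m. i = Suc m \<longrightarrow> K_diff F m z = 0)"
  by (cases i) (auto simp: K_mod_eq)

lemma linear_K_diff: "Vector_Spaces.linear (\<lambda>(a::'k::field) c k. a * c k) (\<lambda>a c k. a * c k) (K_diff F i)"
  unfolding K_diff_eq[abs_def] by (rule linear_mvec)

lemma subspace_K_cycles: "K.subspace (K_cycles F i j)"
proof (cases i)
  case 0
  then show ?thesis by (simp add: K_mod_eq kspace_subspace)
next
  case (Suc m)
  interpret f: Vector_Spaces.linear "\<lambda>(a::'a) c k. a * c k" "\<lambda>(a::'a) c k. a * c k" "K_diff F m"
    by (rule linear_K_diff)
  have "K_cycles F i j = K_mod F i j \<inter> {c. K_diff F m c = 0}" by (auto simp: Suc)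
  then show ?thesis
    by (simp add: K_mod_eq K.subspace_inter kspace_subspace f.subspace_kernel)
qed

lemma subspace_K_bounds: "K.subspace (K_bounds F i j)"
proof -
  interpret f: Vector_Spaces.linear "\<lambda>(a::'a) c k. a * c k" "\<lambda>(a::'a) c k. a * c k" "K_diff F i"
    by (rule linear_K_diff)
  show ?thesis unfolding K_bounds_def K_mod_eq by (intro f.subspace_image kspace_subspace)
qed

lemma K_bounds_subset_cycles:
  assumes "graded_free_resolution n I F"
  shows "K_bounds F i j \<subseteq> K_cycles F i j"
proof
  interpret F: aug_res n I "aug_rank F" "aug_shift F" "aug_mat F"
    by unfold_locales (rule aug_resolution_aug[OF assms])
  fix z assume "z \<in> K_bounds F i j"
  then obtain c where c: "c \<in> kspace (rank F (Suc i)) (shift F (Suc i)) j" "z = K_diff F i c"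
    unfolding K_bounds_def K_mod_eq by blast
  have "z \<in> kspace (rank F i) (shift F i) j"
    using const_mat_kspace[OF F.hmat_D[of "Suc i"]] c by (simp add: K_diff_eq)
  moreover have "K_diff F m z = 0" if "i = Suc m" for m
    using F.D_D[of "Suc m"] c(2) that
    by (simp add: K_diff_eq flip: mvec_mmul const_mat_mmul)
  ultimately show "z \<in> K_cycles F i j" by (simp add: K_cycles_iff)
qed

text \<open>With chain maps \<open>f\<close> and \<open>g\<close> in opposite directions,
  \<open>g\<close> after \<open>f\<close> is homotopic to the identity. If \<open>f\<close> maps a
  cycle z to a boundary, applying \<open>g\<close> gives a boundary again, and this differs from z
  by a boundary; hence \<open>f\<close> is injective on homology. Exchanging the resolutions gives
  the reverse inequality.\<close>

lemma tor_dim_mono: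
  fixes I :: "'k::field mpol set"
  assumes resF: "graded_free_resolution n I F" and resG: "graded_free_resolution n I G"
  shows "tor_dim F i j \<le> tor_dim G i j"
proof -
  interpret F: aug_res n I "aug_rank F" "aug_shift F" "aug_mat F"
    by unfold_locales (rule aug_resolution_aug[OF resF])
  interpret G: aug_res n I "aug_rank G" "aug_shift G" "aug_mat G"
    by unfold_locales (rule aug_resolution_aug[OF resG])
  obtain f where f: "\<And>i. hmat n (rank G i) (shift G i) (rank F i) (shift F i) (f i)"
    "mmul (rank G 0) (aug_mat G 0) (f 0) = aug_mat F 0"
    "\<And>i. mmul (rank G (Suc i)) (aug_mat G (Suc i)) (f (Suc i)) = mmul (rank F i) (f i) (aug_mat F (Suc i))"
    using chain_map_exists[OF F.res G.res] by auto
  obtain g where g: "\<And>i. hmat n (rank F i) (shift F i) (rank G i) (shift G i) (g i)"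
    "mmul (rank F 0) (aug_mat F 0) (g 0) = aug_mat G 0"
    "\<And>i. mmul (rank F (Suc i)) (aug_mat F (Suc i)) (g (Suc i)) = mmul (rank G i) (g i) (aug_mat G (Suc i))"
    using chain_map_exists[OF G.res F.res] by auto
  have hF: "hmat n (rank F i) (shift F i) (rank F (Suc i)) (shift F (Suc i)) (aug_mat F (Suc i))" for i
    using F.hmat_D[of "Suc i"] by simp
  have hF0: "hmat n 1 (\<lambda>_. 0) (rank F 0) (shift F 0) (aug_mat F 0)"
    using F.hmat_D[of 0] by simp
  define \<psi> where "\<psi> = (\<lambda>i. mmul (rank G i) (g i) (f i) - idm (rank F i))"
  have h\<psi>: "hmat n (rank F i) (shift F i) (rank F i) (shift F i) (\<psi> i)" for i
    unfolding \<psi>_def by (intro hmat_diff hmat_mmul[OF g(1) f(1)] hmat_idm)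
  have \<psi>0: "mmul (rank F 0) (aug_mat F 0) (\<psi> 0) = 0"
    by (simp add: \<psi>_def mmul_diff_right f g mmul_idm_right[OF hF0] flip: mmul_assoc)
  have D\<psi>: "mmul (rank F (Suc i)) (aug_mat F (Suc i)) (\<psi> (Suc i)) = mmul (rank F i) (\<psi> i) (aug_mat F (Suc i))" for i
  proof -
    have "mmul (rank F (Suc i)) (aug_mat F (Suc i)) (mmul (rank G (Suc i)) (g (Suc i)) (f (Suc i)))
      = mmul (rank G (Suc i)) (mmul (rank G i) (g i) (aug_mat G (Suc i))) (f (Suc i))"
      by (simp add: g(3) flip: mmul_assoc)
    also have "\<dots> = mmul (rank F i) (mmul (rank G i) (g i) (f i)) (aug_mat F (Suc i))"
      by (simp add: f(3) mmul_assoc)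
    finally show ?thesis
      by (simp add: \<psi>_def mmul_diff_left mmul_diff_right mmul_idm_left[OF hF] mmul_idm_right[OF hF])
  qed
  obtain h where h: "\<And>i. hmat n (rank F (Suc i)) (shift F (Suc i)) (rank F i) (shift F i) (h i)"
    "mmul (rank F (Suc 0)) (aug_mat F (Suc 0)) (h 0) = \<psi> 0"
    "\<And>i. mmul (rank F (Suc (Suc i))) (aug_mat F (Suc (Suc i))) (h (Suc i)) =
       \<psi> (Suc i) - mmul (rank F i) (h i) (aug_mat F (Suc i))"
    using homotopy_exists[OF F.res, of \<psi>] h\<psi> \<psi>0 D\<psi> by auto
  let ?f = "mvec (rank F i) (const_mat (f i))" and ?g = "mvec (rank G i) (const_mat (g i))"
  have f_cyc: "?f z \<in> K_cycles G i j" if z: "z \<in> K_cycles F i j" for z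
  proof -
    have "K_diff G m (?f z) = 0" if "i = Suc m" for m
    proof -
      have "K_diff G m (?f z) = mvec (rank F m) (const_mat (f m)) (K_diff F m z)"
        unfolding K_diff_eq \<open>i = Suc m\<close> by (simp add: f(3) flip: mvec_mmul const_mat_mmul)
      then show ?thesis using z that by (simp add: K_cycles_iff)
    qed
    then show ?thesis
      using z const_mat_kspace[OF f(1)] by (simp add: K_cycles_iff)
  qed
  have g_bounds: "?g y \<in> K_bounds F i j" if y: "y \<in> K_bounds G i j" for y
  proof -
    obtain c where c: "c \<in> kspace (rank G (Suc i)) (shift G (Suc i)) j" "y = K_diff G i c"
      using y unfolding K_bounds_def K_mod_eq by blast
    have "?g y = K_diff F i (mvec (rank G (Suc i)) (const_mat (g (Suc i))) c)"
      unfolding K_diff_eq c(2) by (simp add: g(3) flip: mvec_mmul const_mat_mmul)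
    then show ?thesis
      unfolding K_bounds_def K_mod_eq using const_mat_kspace[OF g(1) c(1)] by blast
  qed
  have pre: "z \<in> K_bounds F i j" if z: "z \<in> K_cycles F i j" "?f z \<in> K_bounds G i j" for z
  proof -
    have zk: "z \<in> kspace (rank F i) (shift F i) j" using z(1) by (simp add: K_cycles_iff)
    have "mvec (rank F i) (idm (rank F i)) z = z"
    proof
      fix l
      have "mvec (rank F i) (idm (rank F i)) z l = (\<Sum>k<rank F i. if k = l then z l else 0)"
        unfolding mvec_def idm_def by (intro sum.cong) auto
      then show "mvec (rank F i) (idm (rank F i)) z l = z l" using zk by (auto simp: kspace_def)
    qed
    then have 1: "mvec (rank F i) (const_mat (\<psi> i)) z = ?g (?f z) - z"
      by (simp add: \<psi>_def const_mat_diff const_mat_mmul const_mat_idm mvec_diff_left mvec_mmul)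
    \<comment> \<open>On a cycle the summand of the homotopy identity that starts with the
      differential vanishes, so only \<open>K_diff F i\<close> applied to the image of
      \<open>z\<close> under \<open>h i\<close> is left.\<close>
    have 2: "mvec (rank F i) (const_mat (\<psi> i)) z = K_diff F i (mvec (rank F i) (const_mat (h i)) z)"
    proof (cases i)
      case 0
      then show ?thesis by (simp add: K_diff_eq h(2) flip: mvec_mmul const_mat_mmul)
    next
      case (Suc m)
      have "K_diff F m z = 0" using z(1) Suc by (simp add: K_cycles_iff)
      moreover have "const_mat (\<psi> (Suc m)) = const_mat (mmul (rank F (Suc (Suc m))) (aug_mat F (Suc (Suc m))) (h (Suc m)))
          + const_mat (mmul (rank F m) (h m) (aug_mat F (Suc m)))"
        by (simp add: h(3) const_mat_diff)
      ultimately show ?thesis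
        by (simp add: Suc K_diff_eq mvec_add_left const_mat_mmul mvec_mmul)
    qed
    have "K_diff F i (mvec (rank F i) (const_mat (h i)) z) \<in> K_bounds F i j"
      unfolding K_bounds_def K_mod_eq using const_mat_kspace[OF h(1) zk] by blast
    then have "?g (?f z) - z \<in> K_bounds F i j" using 1 2 by simp
    then show ?thesis
      using K.subspace_diff[OF subspace_K_bounds g_bounds[OF z(2)]] by fastforce
  qed
  show ?thesis
    unfolding tor_dim_def dim_K_def
  proof (rule K.dim_quotient_mono[of ?f])
    show "K_cycles F i j \<subseteq> K.span ((\<lambda>k l. if l = k then 1 else 0) ` {k. k < rank F i \<and> shift F i k = j})"
      "K_cycles G i j \<subseteq> K.span ((\<lambda>k l. if l = k then 1 else 0) ` {k. k < rank G i \<and> shift G i k = j})"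
      unfolding kspace_eq_span[symmetric] by (auto simp: K_cycles_iff)
  qed (use f_cyc pre resF resG in \<open>auto intro: linear_mvec subspace_K_cycles subspace_K_bounds
      dest: K_bounds_subset_cycles[THEN subsetD, rotated]\<close>)
qed

lemma tor_dim_unique:
  "graded_free_resolution n I F \<Longrightarrow> graded_free_resolution n I G \<Longrightarrow> tor_dim F = tor_dim G"
  by (intro ext antisym tor_dim_mono)

text \<open>The existence of \<open>F\<close> ensures that \<open>SOME\<close> yields a resolution,
  and any two resolutions agree in homology.\<close>

lemma betti_eq_tor_dim: "graded_free_resolution n I F \<Longrightarrow> betti n I = tor_dim F"
  unfolding betti_def by (rule tor_dim_unique) (rule someI)

text \<open>After tensoring with K all differentials vanish, so the homology is the whole
  module.\<close>

lemma tor_dim_minimal: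
  assumes "\<And>i l k. l < rank F i \<Longrightarrow> k < rank F (Suc i) \<Longrightarrow> lookup (dmat F i l k) 0 = 0"
  shows "tor_dim F i j = card {k. k < rank F i \<and> shift F i k = j}"
proof -
  have 0: "K_diff F i c = 0" for i c
    using assms by (simp add: K_diff_def fun_eq_iff)
  then have "K_cycles F i j = kspace (rank F i) (shift F i) j" by (auto simp: K_cycles_iff)
  moreover have "K_bounds F i j = {0}"
    unfolding K_bounds_def K_mod_eq using K.subspace_0[OF kspace_subspace] by (auto simp: 0 image_iff)
  moreover have "dim_K {0 :: nat \<Rightarrow> 'a} = 0"
    unfolding dim_K_def 
    using K.dim_span[of "{} :: (nat \<Rightarrow> 'a) set"] K.dim_eq_card_independent[OF K.independent_empty]
    by (metis K.span_empty card.empty)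
  ultimately show ?thesis unfolding tor_dim_def by (simp add: dim_kspace)
qed

section \<open>Mapping cones\<close>

definition append_vec :: "nat \<Rightarrow> (nat \<Rightarrow> 'a) \<Rightarrow> (nat \<Rightarrow> 'a) \<Rightarrow> nat \<Rightarrow> 'a" where
  "append_vec p a b = (\<lambda>k. if k < p then a k else b (k - p))"

text \<open>The upper triangular block matrix with rows (M, N) and (0, P), where \<open>M\<close>
  has \<open>p\<close> rows and \<open>q\<close> columns.\<close>

definition block_mat :: "nat \<Rightarrow> nat \<Rightarrow> (nat \<Rightarrow> nat \<Rightarrow> 'a::zero) \<Rightarrow> (nat \<Rightarrow> nat \<Rightarrow> 'a) \<Rightarrow> (nat \<Rightarrow> nat \<Rightarrow> 'a) \<Rightarrow>
    nat \<Rightarrow> nat \<Rightarrow> 'a" where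
  "block_mat p q M N P = (\<lambda>l k. if l < p then (if k < q then M l k else N l (k - q))
     else if k < q then 0 else P (l - p) (k - q))"

lemma sum_lessThan_add: "(\<Sum>k<q + q'. f k) = (\<Sum>k<q. f k) + (\<Sum>k<q'. f (q + k :: nat))"
  for f :: "nat \<Rightarrow> 'a::comm_monoid_add"
  by (induction q') (simp_all add: add.assoc)

lemma mvec_block_mat:
  "mvec (q + q') (block_mat p q M N P) (append_vec q a b) = append_vec p (mvec q M a + mvec q' N b) (mvec q' P b)"
  by (auto simp: mvec_def block_mat_def append_vec_def fun_eq_iff sum_lessThan_add)

lemma append_vec_vecs: "a \<in> vecs n p \<Longrightarrow> b \<in> vecs n q \<Longrightarrow> append_vec p a b \<in> vecs n (p + q)"
  by (simp add: vecs_def append_vec_def)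

lemma vecs_add_cases:
  assumes "v \<in> vecs n (p + q)"
  obtains a b where "a \<in> vecs n p" "b \<in> vecs n q" "v = append_vec p a b"
proof (rule that)
  show "(\<lambda>k. if k < p then v k else 0) \<in> vecs n p" "(\<lambda>k. v (p + k)) \<in> vecs n q"
    using assms by (simp_all add: vecs_def)
  show "v = append_vec p (\<lambda>k. if k < p then v k else 0) (\<lambda>k. v (p + k))"
    by (simp add: append_vec_def fun_eq_iff)
qed

lemma append_vec_eq_0_iff:
  assumes "a \<in> vecs n p" shows "append_vec p a b = 0 \<longleftrightarrow> a = 0 \<and> b = 0"
proof
  assume 0: "append_vec p a b = 0"
  have "a k = 0" for k
    using fun_cong[OF 0, of k] assms by (cases "k < p") (simp_all add: append_vec_def vecs_def)
  moreover have "b k = 0" for k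
    using fun_cong[OF 0, of "p + k"] by (simp add: append_vec_def)
  ultimately show "a = 0 \<and> b = 0" by (simp add: fun_eq_iff)
qed (simp add: append_vec_def fun_eq_iff)

lemma block_mat_hmat:
  assumes "hmat n p s q t M" "hmat n p s q' t' N" "hmat n p' s' q' t' P"
  shows "hmat n (p + p') (append_vec p s s') (q + q') (append_vec q t t') (block_mat p q M N P)"
proof (rule hmatI)
  fix l k assume "l < p + p'" "k < q + q'"
  then show "block_mat p q M N P l k \<in> homog n (append_vec q t t' k - append_vec p s s' l)"
    using hmat_entry[OF assms(1), of l k] hmat_entry[OF assms(2), of l "k - q"]
      hmat_entry[OF assms(3), of "l - p" "k - q"]
    by (auto simp: block_mat_def append_vec_def)
next
  fix l k assume "\<not> (l < p + p' \<and> k < q + q')"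
  then have "\<not> k - q < q' \<or> \<not> l - p < p'" "\<not> l < p \<or> \<not> k - q < q'" "\<not> k < q \<or> \<not> l < p" by auto
  then show "block_mat p q M N P l k = 0"
    using hmat_outside[OF assms(1), of l k] hmat_outside[OF assms(2), of l "k - q"]
      hmat_outside[OF assms(3), of "l - p" "k - q"]
    by (auto simp: block_mat_def)
qed

text \<open>Index 0 holds only the S of the first complex. The S of the second complex moves to
  index 1, where it becomes the basis element mapped to the new generator.\<close>

definition cone_rank :: "(nat \<Rightarrow> nat) \<Rightarrow> (nat \<Rightarrow> nat) \<Rightarrow> nat \<Rightarrow> nat" where
  "cone_rank r r' i = r i + (case i of 0 \<Rightarrow> 0 | Suc m \<Rightarrow> r' m)"

definition cone_shift :: "(nat \<Rightarrow> nat) \<Rightarrow> (nat \<Rightarrow> nat \<Rightarrow> int) \<Rightarrow> (nat \<Rightarrow> nat \<Rightarrow> int) \<Rightarrow> int \<Rightarrow> nat \<Rightarrow> nat \<Rightarrow> int" where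
  "cone_shift r s s' e i = (case i of 0 \<Rightarrow> s 0 | Suc m \<Rightarrow> append_vec (r i) (s i) (\<lambda>k. s' m k + e))"

text \<open>Monomial ideals are of this form, with \<open>U\<close> the exponents of their
  monomials. Sums and colons by a monomial then become operations on sets of exponents.\<close>

definition mpol_span :: "expo set \<Rightarrow> 'k::field mpol set" where
  "mpol_span U = {p. keys p \<subseteq> U}"

lemma lookup_monom_mult: "lookup (monom u * p :: 'k::field mpol) (u + w) = lookup p w"
proof -
  have "(lookup p v when u + w = u + v) = (lookup p v when v = w)" for v
    by (auto simp: when_def)
  moreover have "lookup (monom u :: 'k mpol) l * x = (x when l = u)" for l x
    by (auto simp: monom_def lookup_single when_def)
  ultimately show ?thesis
    unfolding lookup_mult by (simp only: Sum_any_when_equal)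
qed

lemma keys_monom_mult: "keys (monom u * p :: 'k::field mpol) = (+) u ` keys p"
proof (intro equalityI subsetI)
  fix w assume "w \<in> keys (monom u * p)"
  then show "w \<in> (+) u ` keys p"
    using keys_mult[of "monom u" p] by (auto simp: monom_def)
next
  fix w assume "w \<in> (+) u ` keys p"
  then show "w \<in> keys (monom u * p)" by (auto simp: in_keys_iff lookup_monom_mult)
qed

text \<open>The ideal J + (u). The factor \<open>x\<close> collects the terms of \<open>p\<close>
  outside \<open>U\<close>, divided by \<open>u\<close>; what remains of \<open>p\<close> is
  supported in \<open>U\<close>.\<close>

lemma mpol_span_Un_shift:
  assumes "U \<subseteq> expos n" "u \<in> expos n"
  shows "p \<in> mpol_span (U \<union> (+) u ` expos n) \<longleftrightarrow>
    (\<exists>q\<in>mpol_span U. \<exists>x\<in>carrier (poly_ring n). p = q + monom u * x)"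
proof
  assume p: "p \<in> mpol_span (U \<union> (+) u ` expos n)"
  define x where "x = (\<Sum>w\<in>{w\<in>expos n. u + w \<in> keys p - U}. Poly_Mapping.single w (lookup p (u + w)))"
  have fin: "finite {w\<in>expos n. u + w \<in> keys p - U}"
    by (rule finite_subset[OF _ finite_vimageI[OF finite_keys[of p], of "(+) u"]]) (auto simp: inj_on_def)
  have lx: "lookup x w = (if w \<in> expos n \<and> u + w \<in> keys p - U then lookup p (u + w) else 0)" for w
    unfolding x_def lookup_sum lookup_single using fin by (auto simp: when_def)
  have x: "x \<in> carrier (poly_ring n)"
    by (auto simp: carrier_poly_ring in_keys_iff lx split: if_splits)
  have "p - monom u * x \<in> mpol_span U"
    unfolding mpol_span_def
  proof (intro CollectI subsetI, rule ccontr)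
    fix w assume w: "w \<in> keys (p - monom u * x)" "w \<notin> U"
    have "w \<in> keys p \<union> keys (monom u * x)" using w(1) keys_diff[of p "monom u * x"] by blast
    then have "w \<in> keys p"
      by (auto simp: keys_monom_mult in_keys_iff lx split: if_splits)
    then obtain v where v: "v \<in> expos n" "w = u + v" using p w(2) by (auto simp: mpol_span_def)
    then show False
      using w \<open>w \<in> keys p\<close> by (simp add: in_keys_iff lookup_minus lookup_monom_mult lx)
  qed
  then show "\<exists>q\<in>mpol_span U. \<exists>x\<in>carrier (poly_ring n). p = q + monom u * x"
    using x by (intro bexI[of _ "p - monom u * x"] bexI[of _ x]) auto
next
  assume "\<exists>q\<in>mpol_span U. \<exists>x\<in>carrier (poly_ring n). p = q + monom u * x"
  then obtain q x where "q \<in> mpol_span U" "x \<in> carrier (poly_ring n)" "p = q + monom u * x" by blast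
  then show "p \<in> mpol_span (U \<union> (+) u ` expos n)"
    unfolding mpol_span_def carrier_poly_ring mem_Collect_eq
    using mpol_add_closed[of q "U \<union> (+) u ` expos n" "monom u * x"] keys_monom_mult[of u x] by blast
qed

lemma monom_mult_mem_mpol_span:
  "p \<in> carrier (poly_ring n) \<Longrightarrow> monom u * p \<in> mpol_span U \<longleftrightarrow> p \<in> mpol_span {w \<in> expos n. u + w \<in> U}"
  by (auto simp: mpol_span_def keys_monom_mult carrier_poly_ring)

text \<open>The complex for the larger ideal is the mapping cone of a lift of multiplication by \<open>u\<close>,
  from the resolution of \<open>S / (J : u)\<close> shifted by \<open>deg u\<close> to the resolution of \<open>S / J\<close>.
  The degree condition forces the lift to have no constant entries.\<close>

lemma mapping_cone:
  fixes D D' :: "nat \<Rightarrow> nat \<Rightarrow> nat \<Rightarrow> 'k::field mpol"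
  assumes J: "aug_resolution n (mpol_span U) r s D" "\<And>i. const_mat (D i) = 0"
    and L: "aug_resolution n (mpol_span {w \<in> expos n. u + w \<in> U}) r' s' D'" "\<And>i. const_mat (D' i) = 0"
    and U: "U \<subseteq> expos n" and u: "u \<in> expos n"
    and deg: "\<And>i k l. k < r i \<Longrightarrow> l < r' i \<Longrightarrow> s i k < s' i l + int (deg u)"
  obtains E :: "nat \<Rightarrow> nat \<Rightarrow> nat \<Rightarrow> 'k mpol" where "aug_resolution n (mpol_span (U \<union> (+) u ` expos n))
      (cone_rank r r') (cone_shift r s s' (int (deg u))) E" "\<And>i. const_mat (E i) = 0"
proof -
  interpret J: aug_res n "mpol_span U" r s D by unfold_locales fact
  interpret L: aug_res n "mpol_span {w \<in> expos n. u + w \<in> U}" r' s' D' by unfold_locales fact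
  let ?e = "int (deg u)"
  \<comment> \<open>Multiplication by \<open>u\<close> from the S of the second complex to the S of
    the first, as a 1 by 1 matrix.\<close>
  define Y0 :: "nat \<Rightarrow> nat \<Rightarrow> 'k mpol" where "Y0 = (\<lambda>l k. if l = 0 \<and> k = 0 then monom u else 0)"
  have hY0: "hmat n (r 0) (s 0) (r' 0) (\<lambda>k. s' 0 k + ?e) Y0"
    using u homog_monom[of u n] by (intro hmatI) (auto simp: Y0_def J.r0 L.r0 J.s0 L.s0)
  have mvec_Y0: "mvec (r' 0) Y0 v = (\<lambda>l. if l = 0 then monom u * v 0 else 0)" for v
    by (auto simp: mvec_def Y0_def L.r0)
  \<comment> \<open>The minus sign makes the lift anticommute with the differentials, so that
    consecutive block matrices compose to zero with \<open>D'\<close> entering unsigned.\<close>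
  define \<psi> where "\<psi> = (\<lambda>i :: nat. if i = 0 then - mmul (r' 0) Y0 (D' 0) else 0)"
  have \<psi>0: "hmat n (r 0) (s 0) (r' 1) (\<lambda>k. s' 1 k + ?e) (- mmul (r' 0) Y0 (D' 0))"
    using hmat_uminus[OF hmat_mmul[OF hY0 hmat_shift[OF L.hmat_D[of 0]]]] by simp
  obtain X where X: "\<And>i. hmat n (r (Suc i)) (s (Suc i)) (r' (Suc i)) (\<lambda>k. s' (Suc i) k + ?e) (X i)"
    "mmul (r 1) (D 0) (X 0) = \<psi> 0"
    "\<And>i. mmul (r (Suc (Suc i))) (D (Suc i)) (X (Suc i)) = \<psi> (Suc i) + mmul (r' (Suc i)) (X i) (- D' (Suc i))"
  proof (rule lift_sequence[where a = "\<lambda>i. r' (Suc i)" and \<sigma> = "\<lambda>i k. s' (Suc i) k + ?e" and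
        A = "\<lambda>i. - D' (Suc i)" and b = r and \<tau> = s and B = D and \<psi> = \<psi> and n = n])
    show "hmat n (r i) (s i) (r' (Suc i)) (\<lambda>k. s' (Suc i) k + ?e) (\<psi> i)" for i
      using \<psi>0 by (simp add: \<psi>_def)
    show "hmat n (r' (Suc i)) (\<lambda>k. s' (Suc i) k + ?e) (r' (Suc (Suc i))) (\<lambda>k. s' (Suc (Suc i)) k + ?e)
        (- D' (Suc i))" for i
      by (intro hmat_uminus hmat_shift L.hmat_D)
    show "mmul (r' (Suc (Suc i))) (- D' (Suc i)) (- D' (Suc (Suc i))) = 0" for i
      by (simp add: mmul_uminus_left mmul_uminus_right L.D_D)
    show "mmul (r (Suc i)) (D i) (\<psi> (Suc i)) = - mmul (r' (Suc i)) (\<psi> i) (- D' (Suc i))" for i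
      by (simp add: \<psi>_def mmul_uminus_left mmul_uminus_right mmul_assoc L.D_D)
    show "(\<lambda>l. \<psi> 0 l k) \<in> mvec (r 1) (D 0) ` vecs n (r 1)" if "k < r' (Suc 0)" for k
      unfolding J.image_D0
    proof (intro CollectI conjI)
      show "(\<lambda>l. \<psi> 0 l k) \<in> vecs n 1"
        using hvec_vecs[OF hmat_column[OF \<psi>0]] that by (simp add: \<psi>_def J.r0)
      have "\<psi> 0 0 k = - (monom u * D' 0 0 k)"
        using fun_cong[OF mmul_column[of "r' 0" Y0 "D' 0" k], of 0]
        by (simp add: \<psi>_def mvec_Y0 fun_Compl_def)
      moreover have "D' 0 0 k \<in> mpol_span {w \<in> expos n. u + w \<in> U}"
        using L.column_D0 that by simp
      then have "monom u * D' 0 0 k \<in> mpol_span U"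
        using monom_mult_mem_mpol_span L.I_carrier by blast
      ultimately show "\<psi> 0 0 k \<in> mpol_span U" by (simp add: mpol_span_def)
    qed
  qed (rule J.hmat_D J.exact_D | assumption | blast)+
  define Y where "Y = (\<lambda>i. case i of 0 \<Rightarrow> Y0 | Suc m \<Rightarrow> X m)"
  have hY: "hmat n (r i) (s i) (r' i) (\<lambda>k. s' i k + ?e) (Y i)" for i
    using hY0 X(1) by (cases i) (simp_all add: Y_def)
  have DY: "mmul (r (Suc i)) (D i) (Y (Suc i)) = - mmul (r' i) (Y i) (D' i)" for i
    using X(2,3) by (cases i) (simp_all add: Y_def \<psi>_def mmul_uminus_right)
  have cY: "const_mat (Y i) = 0" for i
  proof (intro ext, rule ccontr)
    fix l k assume "const_mat (Y i) l k \<noteq> 0 l k"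
    then show False using const_mat_nonzero[OF hY, of i l k] deg[of l i k] by auto
  qed
  \<comment> \<open>The second summand of the cone starts at index 1, hence the shift of the index;
    \<open>P 0\<close> is a block without rows.\<close>
  define P where "P = (\<lambda>i. case i of 0 \<Rightarrow> 0 | Suc m \<Rightarrow> D' m)"
  define E where "E = (\<lambda>i. block_mat (r i) (r (Suc i)) (D i) (Y i) (P i))"
  define q where "q = (\<lambda>i. case i of 0 \<Rightarrow> 0 | Suc m \<Rightarrow> r' m)"
  define sq where "sq = (\<lambda>i. case i of 0 \<Rightarrow> (\<lambda>_. 0) | Suc m \<Rightarrow> (\<lambda>k. s' m k + ?e))"
  have hP: "hmat n (q i) (sq i) (r' i) (\<lambda>k. s' i k + ?e) (P i)" for i
    using hmat_shift[OF L.hmat_D] by (cases i) (auto simp: P_def q_def sq_def)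
  have rank: "cone_rank r r' i = r i + q i" "cone_rank r r' (Suc i) = r (Suc i) + r' i" for i
    by (simp_all add: cone_rank_def q_def split: nat.splits)
  have shift0: "cone_shift r s s' ?e 0 = (\<lambda>_. 0)"
    by (simp add: cone_shift_def J.s0)
  have shift: "cone_shift r s s' ?e i = append_vec (r i) (s i) (sq i)" for i
    by (cases i) (auto simp: cone_shift_def sq_def append_vec_def J.s0 fun_eq_iff)
  have hE: "hmat n (cone_rank r r' i) (cone_shift r s s' ?e i) (cone_rank r r' (Suc i))
      (cone_shift r s s' ?e (Suc i)) (E i)" for i
    using block_mat_hmat[OF J.hmat_D hY hP, of i]
    unfolding E_def rank shift by (simp add: sq_def q_def)
  have mvec_E: "mvec (cone_rank r r' (Suc i)) (E i) (append_vec (r (Suc i)) a b) =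
      append_vec (r i) (mvec (r (Suc i)) (D i) a + mvec (r' i) (Y i) b) (mvec (r' i) (P i) b)" for i a b
    unfolding E_def rank(2) mvec_block_mat ..
  have constE: "const_mat (E i) = 0" for i
  proof (intro ext)
    have "const_mat (P i) = 0" using L(2) by (cases i) (simp_all add: P_def)
    then show "const_mat (E i) l k = 0 l k" for l k
      using fun_cong[OF fun_cong[OF J(2)]] fun_cong[OF fun_cong[OF cY]]
      by (auto simp: E_def block_mat_def const_mat_def fun_eq_iff)
  qed
  have DYv: "mvec (r (Suc i)) (D i) (mvec (r' (Suc i)) (Y (Suc i)) b) = - mvec (r' i) (Y i) (mvec (r' (Suc i)) (D' i) b)"
    for i b
    using DY[of i] by (simp add: mvec_uminus_left flip: mvec_mmul)
  have DDv: "mvec (r (Suc i)) (D i) (mvec (r (Suc (Suc i))) (D (Suc i)) a) = 0" for i a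
    by (simp add: J.D_D flip: mvec_mmul)
  have PDv: "mvec (r' i) (P i) (mvec (r' (Suc i)) (D' i) b) = 0" for i b
    by (cases i) (simp_all add: P_def L.D_D flip: mvec_mmul)
  have ker: "{v \<in> vecs n (cone_rank r r' (Suc i)). mvec (cone_rank r r' (Suc i)) (E i) v = 0} =
      mvec (cone_rank r r' (Suc (Suc i))) (E (Suc i)) ` vecs n (cone_rank r r' (Suc (Suc i)))" for i
  proof (intro equalityI subsetI)
    fix v assume "v \<in> mvec (cone_rank r r' (Suc (Suc i))) (E (Suc i)) ` vecs n (cone_rank r r' (Suc (Suc i)))"
    then obtain w where w: "w \<in> vecs n (cone_rank r r' (Suc (Suc i)))"
      "v = mvec (cone_rank r r' (Suc (Suc i))) (E (Suc i)) w" by blast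
    obtain a b where ab: "w = append_vec (r (Suc (Suc i))) a b"
      using w(1) unfolding rank(2) by (rule vecs_add_cases)
    have "mvec (cone_rank r r' (Suc i)) (E i) v = 0"
      unfolding w(2) ab mvec_E
      by (simp add: P_def mvec_E mvec_add DYv DDv PDv[unfolded P_def]) (simp add: append_vec_def zero_fun_def)
    then show "v \<in> {v \<in> vecs n (cone_rank r r' (Suc i)). mvec (cone_rank r r' (Suc i)) (E i) v = 0}"
      using mvec_vecs[OF hE w(1)] w(2) by simp
  next
    fix v assume "v \<in> {v \<in> vecs n (cone_rank r r' (Suc i)). mvec (cone_rank r r' (Suc i)) (E i) v = 0}"
    then have v: "v \<in> vecs n (r (Suc i) + r' i)" "mvec (cone_rank r r' (Suc i)) (E i) v = 0"
      by (simp_all add: rank(2))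
    obtain a b where ab: "a \<in> vecs n (r (Suc i))" "b \<in> vecs n (r' i)" "v = append_vec (r (Suc i)) a b"
      using v(1) by (rule vecs_add_cases)
    have "mvec (r (Suc i)) (D i) a + mvec (r' i) (Y i) b \<in> vecs n (r i)"
      by (intro vecs_add mvec_vecs[OF J.hmat_D] mvec_vecs[OF hY] ab)
    then have 1: "mvec (r (Suc i)) (D i) a + mvec (r' i) (Y i) b = 0" and 2: "mvec (r' i) (P i) b = 0"
      using v(2) append_vec_eq_0_iff unfolding ab(3) mvec_E by blast+
    have "b \<in> mvec (r' (Suc i)) (D' i) ` vecs n (r' (Suc i))"
    proof (cases i)
      \<comment> \<open>Here \<open>P 0\<close> gives no information on \<open>b\<close>. Instead
        the first coordinate says that u times \<open>b 0\<close> lies in J, so \<open>b 0\<close>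
        lies in the colon ideal, which is the image of \<open>D' 0\<close>.\<close>
      case 0
      have "mvec (r 1) (D 0) a \<in> {v \<in> vecs n 1. v 0 \<in> mpol_span U}"
        using ab(1) J.image_D0 unfolding 0 by auto
      moreover have "monom u * b 0 = - mvec (r 1) (D 0) a 0"
        using fun_cong[OF 1, of 0] by (simp add: 0 Y_def mvec_Y0 add_eq_0_iff)
      ultimately have "monom u * b 0 \<in> mpol_span U" by (simp add: mpol_span_def)
      then have "b 0 \<in> mpol_span {w \<in> expos n. u + w \<in> U}"
        using ab(2) monom_mult_mem_mpol_span[of "b 0" n u U] by (simp add: 0 vecs_def L.r0)
      then show ?thesis
        using ab(2) L.image_D0 by (simp add: 0 L.r0)
    next
      case (Suc m)
      then show ?thesis using L.exact_D[of b m] ab(2) 2 by (simp add: P_def)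
    qed
    then obtain b' where b': "b' \<in> vecs n (r' (Suc i))" "b = mvec (r' (Suc i)) (D' i) b'" by blast
    \<comment> \<open>Subtracting the contribution of the preimage \<open>b'\<close> of
      \<open>b\<close> turns \<open>a\<close> into a cycle of the first complex.\<close>
    have "mvec (r (Suc i)) (D i) (a - mvec (r' (Suc i)) (Y (Suc i)) b') = 0"
      using 1 by (simp add: mvec_diff DYv b'(2))
    then obtain a' where a': "a' \<in> vecs n (r (Suc (Suc i)))"
      "a - mvec (r' (Suc i)) (Y (Suc i)) b' = mvec (r (Suc (Suc i))) (D (Suc i)) a'"
      using J.exact_D[OF vecs_diff[OF ab(1) mvec_vecs[OF hY b'(1)]]] by blast
    have "v = mvec (cone_rank r r' (Suc (Suc i))) (E (Suc i)) (append_vec (r (Suc (Suc i))) a' b')"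
      unfolding mvec_E ab(3) a'(2)[symmetric] by (simp add: P_def b'(2))
    then show "v \<in> mvec (cone_rank r r' (Suc (Suc i))) (E (Suc i)) ` vecs n (cone_rank r r' (Suc (Suc i)))"
      using append_vec_vecs[OF a'(1) b'(1)] unfolding rank(2) by blast
  qed
  have im: "mvec (cone_rank r r' 1) (E 0) ` vecs n (cone_rank r r' 1) =
      {v \<in> vecs n 1. v 0 \<in> mpol_span (U \<union> (+) u ` expos n)}"
  proof (intro equalityI subsetI)
    fix v assume "v \<in> mvec (cone_rank r r' 1) (E 0) ` vecs n (cone_rank r r' 1)"
    then obtain w where w: "w \<in> vecs n (r 1 + r' 0)" "v = mvec (cone_rank r r' 1) (E 0) w"
      using rank(2)[of 0] by auto
    obtain a b where ab: "a \<in> vecs n (r 1)" "b \<in> vecs n (r' 0)" "w = append_vec (r 1) a b"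
      using w(1) by (rule vecs_add_cases)
    have v: "v \<in> vecs n 1"
      using mvec_vecs[OF hE[of 0], of w] w rank(2)[of 0] by (simp add: cone_rank_def J.r0)
    have "v 0 = mvec (r 1) (D 0) a 0 + monom u * b 0"
      using mvec_E[of 0 a b] by (simp add: w(2) ab(3) append_vec_def J.r0 Y_def mvec_Y0)
    moreover have "mvec (r 1) (D 0) a 0 \<in> mpol_span U" using ab(1) J.image_D0 by blast
    moreover have "b 0 \<in> carrier (poly_ring n)" using ab(2) by (simp add: vecs_def L.r0)
    ultimately show "v \<in> {v \<in> vecs n 1. v 0 \<in> mpol_span (U \<union> (+) u ` expos n)}"
      unfolding mem_Collect_eq mpol_span_Un_shift[OF U u] using v by blast
  next
    fix v :: "nat \<Rightarrow> 'k mpol" assume "v \<in> {v \<in> vecs n 1. v 0 \<in> mpol_span (U \<union> (+) u ` expos n)}"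
    then obtain p x where v: "v \<in> vecs n 1" "p \<in> mpol_span U" "x \<in> carrier (poly_ring n)" "v 0 = p + monom u * x"
      unfolding mem_Collect_eq mpol_span_Un_shift[OF U u] by blast
    have "(\<lambda>l. if l = 0 then p else 0) \<in> {v \<in> vecs n 1. v 0 \<in> mpol_span U}"
      using v(2) subsetD[OF J.I_carrier v(2)] by (simp add: vecs_def)
    then obtain a where a: "a \<in> vecs n (r 1)" "(\<lambda>l. if l = 0 then p else 0) = mvec (r 1) (D 0) a"
      using J.image_D0 by blast
    define b where "b = (\<lambda>l. if l = (0::nat) then x else 0)"
    have b: "b \<in> vecs n (r' 0)" using v(3) by (simp add: b_def vecs_def L.r0)
    have "v = mvec (cone_rank r r' 1) (E 0) (append_vec (r 1) a b)"
    proof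
      fix l
      show "v l = mvec (cone_rank r r' 1) (E 0) (append_vec (r 1) a b) l"
        using mvec_E[of 0 a b] fun_cong[OF a(2), of l] v(1,4)
        by (cases "l = 0") (auto simp: append_vec_def J.r0 Y_def mvec_Y0 b_def P_def vecs_def)
    qed
    then show "v \<in> mvec (cone_rank r r' 1) (E 0) ` vecs n (cone_rank r r' 1)"
      using append_vec_vecs[OF a(1) b] rank(2)[of 0] by auto
  qed
  have "mpol_span (U \<union> (+) u ` expos n) \<subseteq> carrier (poly_ring n)"
    using U u expos_add by (fastforce simp: mpol_span_def carrier_poly_ring)
  then have "aug_resolution n (mpol_span (U \<union> (+) u ` expos n)) (cone_rank r r') (cone_shift r s s' ?e) E"
    unfolding aug_resolution_def using hE im ker shift0 by (simp add: cone_rank_def J.r0)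
  then show thesis using constE by (rule that)
qed

section \<open>Monomial ideals and their minimal generators\<close>

text \<open>The exponents of the monomials in the ideal generated by the monomials of
  \<open>A\<close>.\<close>

definition up_set :: "nat \<Rightarrow> expo set \<Rightarrow> expo set" where
  "up_set n A = (\<Union>a\<in>A. (+) a ` expos n)"

lemma up_set_simps [simp]:
  "up_set n {} = {}" "up_set n (insert u A) = up_set n A \<union> (+) u ` expos n"
  by (auto simp: up_set_def)

lemma up_setI: "a \<in> A \<Longrightarrow> v \<in> expos n \<Longrightarrow> a + v \<in> up_set n A"
  by (auto simp: up_set_def)

lemma up_setE: "w \<in> up_set n A \<Longrightarrow> (\<And>a v. a \<in> A \<Longrightarrow> v \<in> expos n \<Longrightarrow> w = a + v \<Longrightarrow> P) \<Longrightarrow> P"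
  by (auto simp: up_set_def)

lemma up_set_expos: "A \<subseteq> expos n \<Longrightarrow> up_set n A \<subseteq> expos n"
  using expos_add by (auto simp: up_set_def)

lemma subset_up_set: "A \<subseteq> up_set n A"
  using up_setI[of _ A 0 n] by auto

lemma up_set_add: "w \<in> up_set n A \<Longrightarrow> v \<in> expos n \<Longrightarrow> w + v \<in> up_set n A"
  by (erule up_setE) (simp add: add.assoc up_setI expos_add)

lemma monom_mem_mpol_span [simp]: "(monom u :: 'k::field mpol) \<in> mpol_span U \<longleftrightarrow> u \<in> U"
  by (simp add: mpol_span_def monom_def)

lemma mpol_span_eq_iff: "mpol_span U = (mpol_span V :: 'k::field mpol set) \<longleftrightarrow> U = V"
proof
  assume *: "mpol_span U = (mpol_span V :: 'k mpol set)"
  show "U = V"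
    unfolding set_eq_iff monom_mem_mpol_span[where 'k = 'k, symmetric] by (simp add: *)
qed simp

lemma mpol_eq_sum_single: "p = (\<Sum>w\<in>keys p. Poly_Mapping.single w (lookup p w))"
  by (rule poly_mapping_eqI) (auto simp: lookup_sum lookup_single when_def in_keys_iff)

lemma genideal_monom:
  assumes A: "A \<subseteq> expos n"
  shows "genideal (poly_ring n) (monom ` A) = (mpol_span (up_set n A) :: 'k::field mpol set)"
proof
  interpret R: cring "poly_ring n :: 'k mpol ring" by (rule cring_poly_ring)
  have sub: "up_set n A \<subseteq> expos n" using up_set_expos[OF A] .
  have "ideal (mpol_span (up_set n A) :: 'k mpol set) (poly_ring n)"
  proof (rule idealI)
    show "ring (poly_ring n :: 'k mpol ring)" by (rule R.ring_axioms)
    have inv: "inv\<^bsub>add_monoid (poly_ring n)\<^esub> p = - p" if "p \<in> carrier (poly_ring n)" for p :: "'k mpol"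
      using R.minus_equality[of "- p" p] that by (simp add: poly_ring_def a_inv_def)
    show "subgroup (mpol_span (up_set n A) :: 'k mpol set) (add_monoid (poly_ring n))"
    proof
      show "mpol_span (up_set n A) \<subseteq> carrier (add_monoid (poly_ring n))"
        using sub by (auto simp: mpol_span_def poly_ring_def)
      show "inv\<^bsub>add_monoid (poly_ring n)\<^esub> p \<in> mpol_span (up_set n A)"
        if "p \<in> mpol_span (up_set n A)" for p :: "'k mpol"
        using inv[of p] that sub by (auto simp: mpol_span_def carrier_poly_ring)
    qed (simp_all add: mpol_span_def poly_ring_def mpol_add_closed)
    have mult: "p * x \<in> mpol_span (up_set n A)"
      if "p \<in> mpol_span (up_set n A)" "x \<in> carrier (poly_ring n)" for p x :: "'k mpol"
      using keys_mult[of p x] that up_set_add unfolding mpol_span_def carrier_poly_ring by blast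
    show "x \<otimes>\<^bsub>poly_ring n\<^esub> p \<in> mpol_span (up_set n A)" "p \<otimes>\<^bsub>poly_ring n\<^esub> x \<in> mpol_span (up_set n A)"
      if "p \<in> mpol_span (up_set n A)" "x \<in> carrier (poly_ring n)" for p x :: "'k mpol"
      using mult[OF that] by (simp_all add: poly_ring_def mult.commute)
  qed
  then show "genideal (poly_ring n) (monom ` A) \<subseteq> (mpol_span (up_set n A) :: 'k mpol set)"
    using subset_up_set by (intro R.genideal_minimal) (simp_all add: image_subset_iff subsetD[OF subset_up_set])
  have mA: "(monom ` A :: 'k mpol set) \<subseteq> carrier (poly_ring n)"
    using A by (auto simp: carrier_poly_ring monom_def)
  interpret Id: ideal "genideal (poly_ring n) (monom ` A) :: 'k mpol set" "poly_ring n"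
    by (rule R.genideal_ideal[OF mA])
  show "(mpol_span (up_set n A) :: 'k mpol set) \<subseteq> genideal (poly_ring n) (monom ` A)"
  proof
    fix p :: "'k mpol" assume p: "p \<in> mpol_span (up_set n A)"
    have "(\<Sum>w\<in>W. Poly_Mapping.single w (lookup p w)) \<in> genideal (poly_ring n) (monom ` A)"
      if "finite W" "W \<subseteq> up_set n A" for W
      using that
    proof (induction W rule: finite_induct)
      case empty
      then show ?case using Id.zero_closed by (simp add: poly_ring_def)
    next
      case (insert w W)
      obtain a v where av: "a \<in> A" "v \<in> expos n" "w = a + v"
        using insert.prems by (auto elim: up_setE)
      have "Poly_Mapping.single v (lookup p w) \<otimes>\<^bsub>poly_ring n\<^esub> monom a \<in> genideal (poly_ring n) (monom ` A)"
        using av(1,2) R.genideal_self[OF mA] by (intro Id.I_l_closed) (auto simp: carrier_poly_ring)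
      then have "Poly_Mapping.single w (lookup p w) \<in> genideal (poly_ring n) (monom ` A)"
        by (simp add: poly_ring_def monom_def mult_single av(3) add.commute)
      then show ?case
        using insert Id.a_closed by (simp add: poly_ring_def)
    qed
    then show "p \<in> genideal (poly_ring n) (monom ` A)"
      using mpol_eq_sum_single[of p] p by (metis finite_keys mem_Collect_eq mpol_span_def)
  qed
qed

definition min_elems :: "nat \<Rightarrow> expo set \<Rightarrow> expo set" where
  "min_elems n U = {w \<in> U. \<forall>v\<in>U. \<forall>z\<in>expos n. w = v + z \<longrightarrow> v = w}"

text \<open>Induction on the degree: an element that is not minimal is a proper multiple of one of
  smaller degree.\<close>

lemma up_set_min_elems:
  assumes "A \<subseteq> expos n"
  shows "up_set n (min_elems n (up_set n A)) = up_set n A"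
proof (intro equalityI subsetI)
  fix w assume "w \<in> up_set n (min_elems n (up_set n A))"
  then obtain a v where "a \<in> min_elems n (up_set n A)" "v \<in> expos n" "w = a + v"
    by (rule up_setE)
  then have "a \<in> up_set n A" "v \<in> expos n" "w = a + v" by (simp_all add: min_elems_def)
  then show "w \<in> up_set n A" using up_set_add by blast
next
  fix w assume "w \<in> up_set n A"
  then show "w \<in> up_set n (min_elems n (up_set n A))"
  proof (induction "deg w" arbitrary: w rule: less_induct)
    case less
    show ?case
    proof (cases "w \<in> min_elems n (up_set n A)")
      case True
      then show ?thesis using subset_up_set by blast
    next
      case False
      then obtain v z where vz: "v \<in> up_set n A" "z \<in> expos n" "w = v + z" "v \<noteq> w"
        using less.prems unfolding min_elems_def by blast
      then have "deg v < deg w"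
        using deg_add[of v z] deg_eq_0_iff[of z] by (metis add.right_neutral gr0I less_add_same_cancel1)
      then show ?thesis using less.hyps[OF _ vz(1)] up_set_add vz by blast
    qed
  qed
qed

text \<open>A minimal element is a multiple of a generator only by being that generator, so no
  generating set omits it. This yields both the uniqueness and the irredundancy demanded by
  \<open>THE\<close> in \<open>min_gens\<close>.\<close>

lemma min_elems_subset:
  assumes "A \<subseteq> expos n" "G \<subseteq> expos n" "up_set n G = up_set n A"
  shows "min_elems n (up_set n A) \<subseteq> G"
proof
  fix w assume w: "w \<in> min_elems n (up_set n A)"
  then have "w \<in> up_set n G" using assms(3) by (simp add: min_elems_def)
  then obtain a v where "a \<in> G" "v \<in> expos n" "w = a + v" by (rule up_setE)
  moreover from this have "a \<in> up_set n A" using subset_up_set assms(3) by blast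
  ultimately have "a = w" "a \<in> G" using w by (simp_all add: min_elems_def)
  then show "w \<in> G" by simp
qed

lemma min_gens_eq:
  assumes A: "A \<subseteq> expos n"
  shows "min_gens n (mpol_span (up_set n A) :: 'k::field mpol set) = min_elems n (up_set n A)"
proof -
  let ?I = "mpol_span (up_set n A) :: 'k mpol set" and ?M = "min_elems n (up_set n A)"
  have M: "?M \<subseteq> expos n" using up_set_expos[OF A] by (auto simp: min_elems_def)
  have gen: "genideal (poly_ring n) (monom ` G) = ?I \<longleftrightarrow> up_set n G = up_set n A" if "G \<subseteq> expos n" for G
    unfolding genideal_monom[OF that] by (rule mpol_span_eq_iff)
  show ?thesis
    unfolding min_gens_def
  proof (rule the_equality)
    show "?M \<subseteq> expos n \<and> genideal (poly_ring n) (monom ` ?M) = ?I \<and>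
        (\<forall>H. H \<subset> ?M \<longrightarrow> genideal (poly_ring n) (monom ` H) \<noteq> ?I)"
    proof (intro conjI allI impI notI)
      show "genideal (poly_ring n) (monom ` ?M) = ?I"
        using gen[OF M] up_set_min_elems[OF A] by simp
      fix H assume H: "H \<subset> ?M" "genideal (poly_ring n) (monom ` H) = ?I"
      then have "H \<subseteq> expos n" using M by auto
      then show False using min_elems_subset[OF A] gen H by (metis psubset_eq subset_antisym)
    qed (rule M)
    fix G assume G: "G \<subseteq> expos n \<and> genideal (poly_ring n) (monom ` G) = ?I \<and>
        (\<forall>H. H \<subset> G \<longrightarrow> genideal (poly_ring n) (monom ` H) \<noteq> ?I)"
    then have "?M \<subseteq> G" using min_elems_subset[OF A] gen[of G] by simp
    moreover have "\<not> ?M \<subset> G"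
    proof
      assume "?M \<subset> G"
      then have "genideal (poly_ring n) (monom ` ?M) \<noteq> ?I" using G by blast
      then show False using gen[OF M] up_set_min_elems[OF A] by simp
    qed
    ultimately show "G = ?M" by auto
  qed
qed

section \<open>Resolutions from linear quotients\<close>

text \<open>S at index 0 and nothing else: the start of both inductions by mapping cones.\<close>

lemma resolution_zero_ideal:
  "aug_resolution n (mpol_span {}) (\<lambda>i. if i = 0 then 1 else 0) (\<lambda>_ _. 0)
     (\<lambda>_. 0 :: nat \<Rightarrow> nat \<Rightarrow> 'k::field mpol)"
proof -
  have "v = 0" if "v \<in> vecs n 0" for v :: "nat \<Rightarrow> 'k mpol"
    using that by (simp add: vecs_def fun_eq_iff)
  then have 0: "vecs n 0 = {0 :: nat \<Rightarrow> 'k mpol}" using vecs_zero by blast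
  have "v = 0" if "v \<in> vecs n 1" "v 0 \<in> mpol_span {}" for v :: "nat \<Rightarrow> 'k mpol"
  proof
    show "v l = 0 l" for l using that by (cases "l = 0") (simp_all add: vecs_def mpol_span_def)
  qed
  moreover have "(0 :: nat \<Rightarrow> 'k mpol) \<in> {v \<in> vecs n 1. v 0 \<in> mpol_span {}}"
    by (simp add: mpol_span_def)
  ultimately have 1: "{v \<in> vecs n 1. v 0 \<in> mpol_span {}} = {0 :: nat \<Rightarrow> 'k mpol}" by blast
  show ?thesis
    unfolding aug_resolution_def
    by (simp add: 0 1[unfolded One_nat_def] carrier_poly_ring subset_iff) (simp add: mpol_span_def)
qed

text \<open>The ideal of the earlier variables is its own colon by a new variable, so the cone is
  built from two copies of one complex. Ranks then obey Pascal's rule, and the basis elements at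
  each index sit in the degree equal to that index.\<close>

lemma resolution_variables:
  assumes "A \<subseteq> {1..n}"
  shows "\<exists>r s (D :: nat \<Rightarrow> nat \<Rightarrow> nat \<Rightarrow> 'k::field mpol).
    aug_resolution n (mpol_span {w \<in> expos n. A \<inter> keys w \<noteq> {}}) r s D \<and> (\<forall>i. const_mat (D i) = 0) \<and>
    (\<forall>i. r i = card A choose i) \<and> (\<forall>i. \<forall>k<r i. s i k = int i)"
proof -
  have "finite A" using assms finite_subset by blast
  then show ?thesis
    using assms
  proof (induction A rule: finite_induct)
    case empty
    show ?case
      by (rule exI[of _ "\<lambda>i. if i = 0 then 1 else 0"], rule exI[of _ "\<lambda>_ _. 0"], rule exI[of _ "\<lambda>_. 0"])
         (use resolution_zero_ideal[of n, where 'k = 'k] in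
           \<open>auto simp: const_mat_def zero_fun_def gr0_conv_Suc\<close>)
  next
    case (insert x A)
    let ?U = "{w \<in> expos n. A \<inter> keys w \<noteq> {}}" and ?x = "Poly_Mapping.single x (1::nat)"
    obtain r s and D :: "nat \<Rightarrow> nat \<Rightarrow> nat \<Rightarrow> 'k mpol"
      where IH: "aug_resolution n (mpol_span ?U) r s D" "\<And>i. const_mat (D i) = 0"
        "\<And>i. r i = card A choose i" "\<And>i k. k < r i \<Longrightarrow> s i k = int i"
      using insert.IH[OF subset_trans[OF subset_insertI insert.prems]] by blast
    have x: "?x \<in> expos n" using insert.prems by (simp add: expos_def)
    have colon: "{w \<in> expos n. ?x + w \<in> ?U} = ?U"
      using insert.hyps expos_add[OF x] by (auto simp: keys_plus_expo)
    have union: "?U \<union> (+) ?x ` expos n = {w \<in> expos n. insert x A \<inter> keys w \<noteq> {}}"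
    proof (intro equalityI subsetI)
      fix w assume "w \<in> ?U \<union> (+) ?x ` expos n"
      then show "w \<in> {w \<in> expos n. insert x A \<inter> keys w \<noteq> {}}"
        using expos_add[OF x] by (auto simp: keys_plus_expo)
    next
      fix w assume w: "w \<in> {w \<in> expos n. insert x A \<inter> keys w \<noteq> {}}"
      show "w \<in> ?U \<union> (+) ?x ` expos n"
      proof (cases "x \<in> keys w")
        case True
        then have eq: "w = ?x + (w - ?x)"
          by (intro poly_mapping_eqI) (auto simp: lookup_add lookup_minus lookup_single when_def in_keys_iff)
        then have "w - ?x \<in> expos n"
          using w keys_plus_expo[of ?x "w - ?x"] by (auto simp: expos_def)
        then show ?thesis using eq by blast
      qed (use w in auto)
    qed
    have L: "aug_resolution n (mpol_span {w \<in> expos n. ?x + w \<in> ?U}) r s D"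
      unfolding colon by (rule IH(1))
    have Usub: "?U \<subseteq> expos n" by blast
    have deg: "s i k < s i l + int (deg ?x)" if "k < r i" "l < r i" for i k l
      using IH(4) that by simp
    obtain E :: "nat \<Rightarrow> nat \<Rightarrow> nat \<Rightarrow> 'k mpol" where
      E: "aug_resolution n (mpol_span (?U \<union> (+) ?x ` expos n))
          (cone_rank r r) (cone_shift r s s (int (deg ?x))) E" "\<And>i. const_mat (E i) = 0"
      using mapping_cone[OF IH(1,2) L IH(2) Usub x deg] by blast
    have rank: "cone_rank r r i = card (insert x A) choose i" for i
      using insert.hyps IH(3) by (cases i) (auto simp: cone_rank_def)
    have shift: "cone_shift r s s (int (deg ?x)) i k = int i" if "k < cone_rank r r i" for i k
      using that IH(4) by (cases i) (auto simp: cone_rank_def cone_shift_def append_vec_def)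
    show ?case
      unfolding union[symmetric] using E rank shift by blast
  qed
qed

lemma card_cone_shift:
  "card {k. k < cone_rank r r' (Suc i) \<and> cone_shift r s s' e (Suc i) k = j} =
     card {k. k < r (Suc i) \<and> s (Suc i) k = j} + card {k. k < r' i \<and> s' i k + e = j}"
proof -
  have "{k. k < cone_rank r r' (Suc i) \<and> cone_shift r s s' e (Suc i) k = j} =
    {k. k < r (Suc i) \<and> s (Suc i) k = j} \<union> (+) (r (Suc i)) ` {k. k < r' i \<and> s' i k + e = j}"
    (is "?A = ?B \<union> ?C")
  proof (intro equalityI subsetI)
    fix k assume k: "k \<in> ?A"
    show "k \<in> ?B \<union> ?C"
    proof (cases "k < r (Suc i)")
      case False
      then have "k = r (Suc i) + (k - r (Suc i))" by simp
      moreover have "k - r (Suc i) \<in> {k. k < r' i \<and> s' i k + e = j}"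
        using k False by (auto simp: cone_rank_def cone_shift_def append_vec_def)
      ultimately show ?thesis by blast
    qed (use k in \<open>auto simp: cone_shift_def append_vec_def\<close>)
  qed (auto simp: cone_rank_def cone_shift_def append_vec_def)
  moreover have "?B \<inter> ?C = {}" by auto
  ultimately show ?thesis
    by (simp add: card_Un_disjoint card_image)
qed

text \<open>The key \<open>f\<close> may take equal values, and the order among ties is arbitrary.
  Hence the colon condition is asked for every \<open>S\<close> that contains all generators of
  smaller key and none of larger key. A generator \<open>u\<close> contributes the ranks of a Koszul
  complex on \<open>V u\<close>, in the degrees \<open>deg u + i\<close>.\<close>

lemma resolution_linear_quotients:
  fixes f :: "expo \<Rightarrow> 'a::linorder" and V :: "expo \<Rightarrow> nat set"
  assumes G: "finite G" "G \<subseteq> expos n" "0 \<notin> G"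
    and mono: "\<And>u w. u \<in> G \<Longrightarrow> w \<in> G \<Longrightarrow> f w \<le> f u \<Longrightarrow> deg w \<le> deg u"
    and V: "\<And>u. u \<in> G \<Longrightarrow> V u \<subseteq> {1..n}"
    and colon: "\<And>u S. u \<in> G \<Longrightarrow> S \<subseteq> G \<Longrightarrow> u \<notin> S \<Longrightarrow> (\<And>w. w \<in> S \<Longrightarrow> f w \<le> f u) \<Longrightarrow>
      (\<And>w. w \<in> G \<Longrightarrow> f w < f u \<Longrightarrow> w \<in> S) \<Longrightarrow>
      {w \<in> expos n. u + w \<in> up_set n S} = {w \<in> expos n. V u \<inter> keys w \<noteq> {}}"
  shows "\<exists>r s (D :: nat \<Rightarrow> nat \<Rightarrow> nat \<Rightarrow> 'k::field mpol).
    aug_resolution n (mpol_span (up_set n G)) r s D \<and> (\<forall>i. const_mat (D i) = 0) \<and>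
    (\<forall>i j. card {k. k < r (Suc i) \<and> s (Suc i) k = j} =
       (\<Sum>u\<in>G. if j = int (deg u + i) then card (V u) choose i else 0))"
proof -
  let ?P = "\<lambda>S. \<exists>r s (D :: nat \<Rightarrow> nat \<Rightarrow> nat \<Rightarrow> 'k mpol).
    aug_resolution n (mpol_span (up_set n S)) r s D \<and> (\<forall>i. const_mat (D i) = 0) \<and>
    (\<forall>i j. card {k. k < r (Suc i) \<and> s (Suc i) k = j} =
       (\<Sum>u\<in>S. if j = int (deg u + i) then card (V u) choose i else 0))"
  have "?P S" if "S \<subseteq> G" "\<And>u w. u \<in> S \<Longrightarrow> w \<in> G \<Longrightarrow> f w < f u \<Longrightarrow> w \<in> S" for S
    using finite_subset[OF that(1) G(1)] that
  proof (induction S rule: finite_ranking_induct[where f = f])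
    case empty
    show ?case
      by (rule exI[of _ "\<lambda>i. if i = 0 then 1 else 0"], rule exI[of _ "\<lambda>_ _. 0"], rule exI[of _ "\<lambda>_. 0"])
         (use resolution_zero_ideal[of n, where 'k = 'k] in
           \<open>simp add: const_mat_def zero_fun_def\<close>)
  next
    case (insert u S)
    show ?case
    \<comment> \<open>The induction rule does not guarantee that the inserted element is
      new.\<close>
    proof (cases "u \<in> S")
      case True
      then show ?thesis using insert.IH insert.prems by (simp add: insert_absorb)
    next
      case False
      have closed: "w \<in> S" if "u' \<in> S" "w \<in> G" "f w < f u'" for u' w
        using insert.prems(2)[of u' w] insert.hyps(2)[of u'] that by auto
      have "?P S"
      proof (rule insert.IH)
        show "S \<subseteq> G" using insert.prems by auto
      qed (rule closed)
      then obtain r s and D :: "nat \<Rightarrow> nat \<Rightarrow> nat \<Rightarrow> 'k mpol"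
        where J: "aug_resolution n (mpol_span (up_set n S)) r s D" "\<And>i. const_mat (D i) = 0"
          and cJ: "\<And>i j. card {k. k < r (Suc i) \<and> s (Suc i) k = j} =
             (\<Sum>u\<in>S. if j = int (deg u + i) then card (V u) choose i else 0)"
        by blast
      have u: "u \<in> G" "u \<in> expos n" "u \<noteq> 0" and S: "S \<subseteq> G" using insert.prems G by auto
      have col: "{w \<in> expos n. u + w \<in> up_set n S} = {w \<in> expos n. V u \<inter> keys w \<noteq> {}}"
        using insert.prems(2)[of u] insert.hyps(2) by (intro colon u S False) auto
      obtain r' s' and D' :: "nat \<Rightarrow> nat \<Rightarrow> nat \<Rightarrow> 'k mpol"
        where L: "aug_resolution n (mpol_span {w \<in> expos n. u + w \<in> up_set n S}) r' s' D'"
          "\<And>i. const_mat (D' i) = 0"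
          and r': "\<And>i. r' i = card (V u) choose i" "\<And>i k. k < r' i \<Longrightarrow> s' i k = int i"
        using resolution_variables[OF V[OF u(1)], where 'k = 'k] unfolding col by auto
      have deg: "s i k < s' i l + int (deg u)" if "k < r i" "l < r' i" for i k l
      proof (cases i)
        case 0
        moreover have "s 0 k = 0" using J(1) by (simp add: aug_resolution_def)
        moreover have "deg u > 0" using u(3) by (metis deg_eq_0_iff gr0I)
        ultimately show ?thesis using r'(2)[OF that(2)] by simp
      next
        case (Suc m)
        \<comment> \<open>The counts by degree are all that is known about the shifts. A nonzero
          count in the degree of \<open>k\<close> exhibits an earlier generator \<open>w\<close>
          with \<open>s (Suc m) k = deg w + m\<close>, and \<open>deg w \<le> deg u\<close> makes
          this smaller than \<open>Suc m + deg u\<close>.\<close>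
        have "k \<in> {k'. k' < r (Suc m) \<and> s (Suc m) k' = s (Suc m) k}" using that Suc by simp
        then have "card {k'. k' < r (Suc m) \<and> s (Suc m) k' = s (Suc m) k} \<noteq> 0" by auto
        then obtain w where "w \<in> S"
          "(if s (Suc m) k = int (deg w + m) then card (V w) choose m else 0) \<noteq> 0"
          unfolding cJ by (rule sum.not_neutral_contains_not_neutral)
        then have "w \<in> S" "s (Suc m) k = int (deg w + m)" by (simp_all split: if_splits)
        then show ?thesis
          using r'(2)[OF that(2)] mono[OF u(1), of w] insert.hyps(2)[of w] S Suc by auto
      qed
      obtain E :: "nat \<Rightarrow> nat \<Rightarrow> nat \<Rightarrow> 'k mpol" where
        E: "aug_resolution n (mpol_span (up_set n S \<union> (+) u ` expos n))
            (cone_rank r r') (cone_shift r s s' (int (deg u))) E" "\<And>i. const_mat (E i) = 0"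
        using mapping_cone[OF J L up_set_expos[OF subset_trans[OF S G(2)]] u(2) deg] by blast
      have "card {k. k < r' i \<and> s' i k + int (deg u) = j} =
          (if j = int (deg u + i) then card (V u) choose i else 0)" for i j
      proof -
        have "{k. k < r' i \<and> s' i k + int (deg u) = j} = (if j = int (deg u + i) then {..<r' i} else {})"
          using r'(2)[of _ i] by auto
        then show ?thesis using r'(1) by simp
      qed
      then have "card {k. k < cone_rank r r' (Suc i) \<and> cone_shift r s s' (int (deg u)) (Suc i) k = j} =
          (\<Sum>u\<in>insert u S. if j = int (deg u + i) then card (V u) choose i else 0)" for i j
        unfolding card_cone_shift cJ using False insert.hyps(1) by simp
      then show ?thesis using E unfolding up_set_simps by blast
    qed
  qed
  then show ?thesis by blast
qed

section \<open>Linear quotients of t-spread strongly stable ideals\<close>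

definition list_expo :: "nat list \<Rightarrow> expo" where
  "list_expo js = (\<Sum>j\<leftarrow>js. Poly_Mapping.single j 1)"

definition spread :: "(nat \<Rightarrow> nat) \<Rightarrow> nat list \<Rightarrow> bool" where
  "spread t js \<longleftrightarrow> (\<forall>r. Suc r < length js \<longrightarrow> js ! r + t (Suc r) \<le> js ! Suc r)"

lemma list_expo_simps [simp]:
  "list_expo [] = 0" "list_expo (j # js) = Poly_Mapping.single j 1 + list_expo js"
  "list_expo (js @ ks) = list_expo js + list_expo ks"
  by (simp_all add: list_expo_def)

lemma lookup_list_expo: "lookup (list_expo js) i = count_list js i"
  by (induction js) (auto simp: lookup_add lookup_single when_def)

lemma keys_list_expo: "keys (list_expo js) = set js"
  by (auto simp: in_keys_iff lookup_list_expo count_list_0_iff)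

lemma deg_list_expo: "deg (list_expo js) = length js"
  by (induction js) (simp_all add: deg_add)

text \<open>Written with sums on both sides because subtraction of exponents truncates; the form
  used in the definition of strong stability follows from it.\<close>

lemma list_expo_update:
  "k < length js \<Longrightarrow> list_expo (js[k := i]) + Poly_Mapping.single (js ! k) 1 = list_expo js + Poly_Mapping.single i 1"
proof (induction js arbitrary: k)
  case (Cons j js)
  then show ?case by (cases k) (simp_all add: ac_simps)
qed simp

lemma list_expo_update_eq:
  assumes "k < length js"
  shows "list_expo js - Poly_Mapping.single (js ! k) 1 + Poly_Mapping.single i 1 = list_expo (js[k := i])"
proof (rule poly_mapping_eqI)
  fix l
  have "lookup (list_expo js) (js ! k) \<noteq> 0"
    using assms by (simp add: lookup_list_expo count_list_0_iff)
  then show "lookup (list_expo js - Poly_Mapping.single (js ! k) 1 + Poly_Mapping.single i 1) l =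
      lookup (list_expo (js[k := i])) l"
    using arg_cong[OF list_expo_update[OF assms, of i], of "\<lambda>p. lookup p l"]
    by (cases "l = js ! k") (auto simp: lookup_add lookup_minus lookup_single when_def split: if_splits)
qed

lemma spread_sorted: "spread t js \<Longrightarrow> sorted js"
  unfolding sorted_iff_nth_Suc spread_def using add_leE by blast

lemma t_spread_iff:
  "t_spread n d t u \<longleftrightarrow> (\<exists>js. u = list_expo js \<and> set js \<subseteq> {1..n} \<and> length js \<le> d \<and> spread t js)"
proof -
  have spread: "(\<forall>r\<in>{1..<length js}. js ! (r - 1) + t r \<le> js ! r) \<longleftrightarrow> spread t js" for js
  proof
    assume *: "\<forall>r\<in>{1..<length js}. js ! (r - 1) + t r \<le> js ! r"
    show "spread t js"
      unfolding spread_def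
    proof (intro allI impI)
      show "js ! r + t (Suc r) \<le> js ! Suc r" if "Suc r < length js" for r
        using bspec[OF *, of "Suc r"] that by simp
    qed
  next
    assume *: "spread t js"
    show "\<forall>r\<in>{1..<length js}. js ! (r - 1) + t r \<le> js ! r"
    proof
      show "js ! (r - 1) + t r \<le> js ! r" if "r \<in> {1..<length js}" for r
        using * that unfolding spread_def by (cases r) auto
    qed
  qed
  have expos: "list_expo js \<in> expos n \<longleftrightarrow> set js \<subseteq> {1..n}" for js
    by (simp add: expos_def keys_list_expo)
  show ?thesis
    unfolding t_spread_def list_expo_def[symmetric] spread using spread_sorted expos by blast
qed

text \<open>Variables \<open>x\<^sub>i\<close> generating the colon ideal of the monomial with index list \<open>js\<close>
  by the preceding generators.\<close>

definition colon_vars :: "(nat \<Rightarrow> nat) \<Rightarrow> nat list \<Rightarrow> nat set" where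
  "colon_vars t js = {1..<last js} - (\<Union>r<length js - 1. {js ! r..<js ! r + t (Suc r)})"

text \<open>By the spread condition each block ends before the next index of the list, so the blocks
  are disjoint and stay below \<open>last js\<close>. Removing them costs exactly the sum of the
  \<open>t l\<close>.\<close>

lemma card_colon_vars:
  assumes js: "spread t js" "js \<noteq> []" "0 \<notin> set js"
  shows "card (colon_vars t js) = last js - 1 - (\<Sum>l = 1..length js - 1. t l)"
proof -
  let ?A = "\<lambda>r. {js ! r..<js ! r + t (Suc r)}" and ?m = "length js - 1"
  have step: "js ! r + t (Suc r) \<le> js ! r'" if "r < r'" "r' < length js" for r r'
    using js(1) sorted_nth_mono[OF spread_sorted[OF js(1)], of "Suc r" r'] that
    unfolding spread_def by (meson Suc_leI le_less_trans le_trans)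
  have "?A r \<inter> ?A r' = {}" if "r < ?m" "r' < ?m" "r \<noteq> r'" for r r'
  proof -
    have "r < length js" "r' < length js" using that by auto
    then show ?thesis using step[of r r'] step[of r' r] that(3) by (cases "r < r'") auto
  qed
  then have "card (\<Union>r<?m. ?A r) = (\<Sum>r<?m. card (?A r))"
    by (intro card_UN_disjoint) auto
  also have "\<dots> = (\<Sum>l = 1..?m. t l)"
    by (simp add: sum.atLeast1_atMost_eq)
  finally have card: "card (\<Union>r<?m. ?A r) = (\<Sum>l = 1..?m. t l)" .
  have "?A r \<subseteq> {1..<last js}" if "r < ?m" for r
  proof -
    have "js ! r \<noteq> 0" using js(3) that by (metis add_lessD1 less_diff_conv nth_mem)
    moreover have "js ! r + t (Suc r) \<le> last js" using step[of r ?m] that js(2) by (simp add: last_conv_nth)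
    ultimately show ?thesis by auto
  qed
  then have "(\<Union>r<?m. ?A r) \<subseteq> {1..<last js}" by blast
  then show ?thesis
    unfolding colon_vars_def by (subst card_Diff_subset) (simp_all only: card, simp_all)
qed

text \<open>At \<open>q\<close> the list \<open>ks\<close> first falls below \<open>js\<close>.
  Blocks at positions before \<open>q\<close> end before \<open>ks ! q\<close>, because there
  \<open>ks\<close> dominates \<open>js\<close> and is itself spread; later blocks begin beyond it.
  Its occurrences in \<open>js\<close> are at positions before \<open>q\<close>, where
  \<open>ks\<close> is squeezed to the same value, and position \<open>q\<close> adds one
  more.\<close>

lemma first_descent_mem_colon_vars:
  assumes js: "spread t js" and ks: "spread t ks" "0 \<notin> set ks" and len: "length ks \<le> length js"
    and q: "q < length ks" "ks ! q < js ! q" and less: "\<And>p. p < q \<Longrightarrow> js ! p \<le> ks ! p"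
  shows "ks ! q \<in> colon_vars t js" and "count_list js (ks ! q) < count_list ks (ks ! q)"
proof -
  let ?i = "ks ! q"
  have sj: "sorted js" and sk: "sorted ks" using js ks spread_sorted by auto
  have qj: "q < length js" using q len by simp
  have "js ! q \<le> last js"
    using sorted_nth_mono[OF sj, of q "length js - 1"] qj last_conv_nth[of js] by fastforce
  moreover have "?i \<noteq> 0" using ks(2) q(1) by (metis nth_mem)
  moreover have "\<not> (js ! r \<le> ?i \<and> ?i < js ! r + t (Suc r))" if r: "r < length js - 1" for r
  proof (cases "r < q")
    case True
    have "js ! r + t (Suc r) \<le> ks ! r + t (Suc r)" using less[OF True] by simp
    also have "\<dots> \<le> ks ! Suc r" using ks(1) True q(1) by (simp add: spread_def)
    also have "\<dots> \<le> ?i" using sorted_nth_mono[OF sk, of "Suc r" q] True q(1) by simp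
    finally show ?thesis by simp
  next
    case False
    then have "js ! q \<le> js ! r" using sorted_nth_mono[OF sj, of q r] r by simp
    then show ?thesis using q(2) by simp
  qed
  ultimately show "?i \<in> colon_vars t js" using q(2) by (auto simp: colon_vars_def)
  have count: "count_list xs x = card {k. k < length xs \<and> xs ! k = x}" for xs :: "nat list" and x
    by (simp add: count_list_eq_length_filter length_filter_conv_card eq_commute)
  have "insert q {k. k < length js \<and> js ! k = ?i} \<subseteq> {k. k < length ks \<and> ks ! k = ?i}"
  proof
    fix k assume k: "k \<in> insert q {k. k < length js \<and> js ! k = ?i}"
    show "k \<in> {k. k < length ks \<and> ks ! k = ?i}"
    proof (cases "k = q")
      case False
      then have kj: "k < length js" "js ! k = ?i" using k by auto
      have "k < q"
        using sorted_nth_mono[OF sj, of q k] kj q(2) by (metis leD leI)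
      then have "ks ! k = ?i"
        using less[of k] kj(2) sorted_nth_mono[OF sk, of k q] q(1) by simp
      then show ?thesis using \<open>k < q\<close> q(1) by simp
    qed (use q in simp)
  qed
  then have "card (insert q {k. k < length js \<and> js ! k = ?i}) \<le> card {k. k < length ks \<and> ks ! k = ?i}"
    by (intro card_mono) auto
  then show "count_list js ?i < count_list ks ?i"
    using q(2) by (simp add: count card_insert_if)
qed

text \<open>Only the junction matters: the last entry taken from \<open>js\<close> is followed by an
  entry of \<open>ks\<close> that is at least the next entry of \<open>js\<close>.\<close>

lemma spread_take_drop:
  assumes "spread t js" "spread t ks" "p \<le> length ks" "length ks \<le> length js"
    and "\<And>r. r < length ks \<Longrightarrow> js ! r \<le> ks ! r"
  shows "spread t (take p js @ drop p ks)"
  unfolding spread_def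
proof (intro allI impI)
  fix r assume r: "Suc r < length (take p js @ drop p ks)"
  have nth: "(take p js @ drop p ks) ! x = (if x < p then js ! x else ks ! x)" if "x < length ks" for x
    using that assms(3,4) by (simp add: nth_append min_absorb2)
  have len: "Suc r < length ks" using r assms(3,4) by simp
  have "js ! r + t (Suc r) \<le> js ! Suc r" "ks ! r + t (Suc r) \<le> ks ! Suc r" "js ! Suc r \<le> ks ! Suc r"
    using len assms(1,2,4) assms(5)[OF len] by (simp_all add: spread_def)
  then show "(take p js @ drop p ks) ! r + t (Suc r) \<le> (take p js @ drop p ks) ! Suc r"
    using len by (auto simp: nth)
qed

section \<open>Exchange properties derived from strong stability, in terms of index lists\<close>

locale stable_up_set =
  fixes n d :: nat and t :: "nat \<Rightarrow> nat" and U :: "expo set"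
  assumes stable: "\<And>js k i. spread t js \<Longrightarrow> set js \<subseteq> {1..n} \<Longrightarrow> length js \<le> d \<Longrightarrow> list_expo js \<in> U \<Longrightarrow>
      k < length js \<Longrightarrow> 1 \<le> i \<Longrightarrow> i < js ! k \<Longrightarrow> spread t (js[k := i]) \<Longrightarrow> list_expo (js[k := i]) \<in> U"
begin

text \<open>The entries of \<open>ks\<close> are replaced by those of \<open>js\<close> from left to
  right. Every intermediate list is spread, and each replacement is trivial or lowers one index, so
  strong stability applies.\<close>

lemma prefix_mem:
  assumes js: "spread t js" "set js \<subseteq> {1..n}" and ks: "spread t ks" "set ks \<subseteq> {1..n}" "length ks \<le> d"
    "list_expo ks \<in> U" and len: "length ks \<le> length js"
    and le: "\<And>r. r < length ks \<Longrightarrow> js ! r \<le> ks ! r"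
  shows "list_expo (take (length ks) js) \<in> U"
proof -
  have "list_expo (take p js @ drop p ks) \<in> U" if "p \<le> length ks" for p
    using that
  proof (induction p)
    case 0
    then show ?case using ks by (simp del: list_expo_simps)
  next
    case (Suc p)
    let ?ls = "take p js @ drop p ks"
    have p: "p < length ks" "p < length js" using Suc.prems len by auto
    have upd: "?ls[p := js ! p] = take (Suc p) js @ drop (Suc p) ks"
      using p by (simp add: list_update_append min_absorb2 take_Suc_conv_app_nth flip: Cons_nth_drop_Suc)
    have nth: "?ls ! p = ks ! p" using p by (simp add: nth_append min_absorb2)
    have IH: "list_expo ?ls \<in> U" using Suc by simp
    show ?case
    proof (cases "js ! p = ks ! p")
      case True
      then show ?thesis using IH upd nth by (metis list_update_id)
    next
      case False
      have "list_expo (?ls[p := js ! p]) \<in> U"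
      proof (rule stable)
        show "spread t ?ls" "spread t (?ls[p := js ! p])"
          unfolding upd using spread_take_drop[OF js(1) ks(1) _ len le] Suc.prems by simp_all
        show "set ?ls \<subseteq> {1..n}" using js(2) ks(2) set_take_subset set_drop_subset by fastforce
        show "1 \<le> js ! p" using js(2) p nth_mem[of p js] by fastforce
        show "js ! p < ?ls ! p" unfolding nth using le[OF p(1)] False by simp
      qed (use p ks(3) IH in auto)
      then show ?thesis by (simp only: upd)
    qed
  qed
  from this[of "length ks"] show ?thesis by simp
qed

text \<open>The entry to replace is the first one exceeding \<open>i\<close>; it exists as
  \<open>i < last js\<close>. Its left neighbour, if any, is at most \<open>i\<close>, and since
  \<open>i\<close> avoids the block of that neighbour, the gap to \<open>i\<close> is large enough.
  The gap to the right only grows.\<close>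

lemma colon_var_exchange:
  assumes js: "spread t js" "set js \<subseteq> {1..n}" "length js \<le> d" "list_expo js \<in> U" "js \<noteq> []"
    and i: "i \<in> colon_vars t js"
  obtains k where "k < length js" "i < js ! k" "list_expo (js[k := i]) \<in> U"
proof -
  have i1: "1 \<le> i" "i < last js" using i by (auto simp: colon_vars_def)
  define k where "k = (LEAST k. k < length js \<and> i < js ! k)"
  have "length js - 1 < length js \<and> i < js ! (length js - 1)"
    using i1 js(5) by (simp add: last_conv_nth)
  then have k: "k < length js" "i < js ! k"
    unfolding k_def by (metis (mono_tags, lifting) LeastI)+
  have below: "js ! r \<le> i" if "r < k" for r
    using not_less_Least[of r "\<lambda>k. k < length js \<and> i < js ! k"] that k(1) unfolding k_def[symmetric] by auto
  have "spread t (js[k := i])"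
    unfolding spread_def
  proof (intro allI impI)
    fix r assume r: "Suc r < length (js[k := i])"
    then have sp: "js ! r + t (Suc r) \<le> js ! Suc r" using js(1) by (simp add: spread_def)
    consider "r = k" | "Suc r = k" | "r \<noteq> k" "Suc r \<noteq> k" by blast
    then show "js[k := i] ! r + t (Suc r) \<le> js[k := i] ! Suc r"
    proof cases
      case 2
      have "\<not> (js ! r \<le> i \<and> i < js ! r + t (Suc r))"
        using i r unfolding colon_vars_def by auto
      then show ?thesis using below[of r] 2 k(1) by auto
    qed (use sp k in auto)
  qed
  then show thesis using stable[OF js(1-4) k(1) i1(1) k(2)] that k by blast
qed

end

text \<open>Orders generators of equal degree: exchanging a variable for one of smaller index lowers
  it.\<close>

definition weight :: "expo \<Rightarrow> nat" where
  "weight u = (\<Sum>i\<in>keys u. i * lookup u i)"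

lemma weight_list_expo: "weight (list_expo js) = sum_list js"
  unfolding weight_def keys_list_expo lookup_list_expo
  using sum_list_map_eq_sum_count[of "\<lambda>x. x" js] by (simp add: mult.commute)

lemma sum_list_update_less:
  "k < length js \<Longrightarrow> i < js ! k \<Longrightarrow> sum_list (js[k := i]) < sum_list (js :: nat list)"
proof (induction js arbitrary: k)
  case (Cons j js)
  then show ?case by (cases k) auto
qed simp

lemma eq_if_sum_list_le:
  fixes js ks :: "nat list"
  assumes "length ks = length js" "\<And>r. r < length ks \<Longrightarrow> js ! r \<le> ks ! r" "sum_list ks \<le> sum_list js"
  shows "ks = js"
  using assms
proof (induction ks js rule: list_induct2)
  case (Cons k ks j js)
  have 1: "j \<le> k" using Cons.prems(1)[of 0] by simp
  have 2: "js ! r \<le> ks ! r" if "r < length ks" for r using Cons.prems(1)[of "Suc r"] that by simp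
  have "sum_list js \<le> sum_list ks" using 2 Cons.hyps by (intro sum_list_mono2) auto
  then have "j = k" "sum_list ks \<le> sum_list js" using Cons.prems(2) 1 by auto
  then show ?case using Cons.IH 2 by simp
qed simp

context stable_up_set
begin

text \<open>For an earlier generator \<open>a\<close>, the quotient by its common factor with
  \<open>u\<close> is divisible by a colon variable. If \<open>ks\<close> dominated
  \<open>js\<close> throughout, \<open>prefix_mem\<close> would put a prefix of \<open>js\<close>
  into \<open>U\<close>; minimality of \<open>u\<close> makes this prefix all of \<open>js\<close>,
  and then the weights force \<open>a = u\<close>.\<close>

lemma colon_up_set_subset:
  assumes G: "G = min_elems n U" and u: "u \<in> G" "u = list_expo js" "spread t js" "set js \<subseteq> {1..n}"
    and a: "a \<in> G" "a = list_expo ks" "spread t ks" "set ks \<subseteq> {1..n}" "length ks \<le> d"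
    and ne: "a \<noteq> u" and le: "(deg a, weight a) \<le> (deg u, weight u)"
  obtains i where "i \<in> colon_vars t js" "lookup u i < lookup a i"
proof -
  have len: "length ks \<le> length js" using le by (auto simp: u(2) a(2) deg_list_expo)
  have "\<exists>q<length ks. ks ! q < js ! q"
  proof (rule ccontr)
    assume "\<not> ?thesis"
    then have ge: "js ! r \<le> ks ! r" if "r < length ks" for r using that by (metis not_le)
    have "list_expo ks \<in> U" using a G by (simp add: min_elems_def)
    then have pre: "list_expo (take (length ks) js) \<in> U"
      using prefix_mem[OF u(3,4) a(3,4,5) _ len ge] by simp
    have "u = list_expo (take (length ks) js) + list_expo (drop (length ks) js)"
      unfolding u(2) by (simp flip: list_expo_simps(3))
    moreover have "list_expo (drop (length ks) js) \<in> expos n"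
      using u(4) set_drop_subset by (fastforce simp: expos_def keys_list_expo)
    ultimately have "list_expo (take (length ks) js) = u"
      using u(1) pre unfolding G min_elems_def by blast
    then have eq: "length ks = length js"
      using deg_list_expo[of js] deg_list_expo[of "take (length ks) js"] len u(2) by simp
    then have "sum_list ks \<le> sum_list js"
      using le by (simp add: u(2) a(2) deg_list_expo weight_list_expo)
    then show False using eq_if_sum_list_le[OF eq ge] ne u(2) a(2) by simp
  qed
  then obtain q where q: "q < length ks" "ks ! q < js ! q" "\<And>p. p < q \<Longrightarrow> \<not> (p < length ks \<and> ks ! p < js ! p)"
    using exists_least_iff[of "\<lambda>q. q < length ks \<and> ks ! q < js ! q"] by blast
  have "js ! p \<le> ks ! p" if "p < q" for p using q(1) q(3)[OF that] that by auto
  moreover have "0 \<notin> set ks" using a(4) by auto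
  ultimately show thesis
    using first_descent_mem_colon_vars[OF u(3) a(3) _ len q(1,2)] that
    by (simp add: u(2) a(2) lookup_list_expo)
qed

text \<open>One inclusion is the preceding lemma. For the other, a colon variable times
  \<open>u\<close> equals an exchanged monomial of \<open>U\<close> times the variable given up, and
  the exchanged monomial is a multiple of a generator \<open>g\<close> with smaller key.\<close>

lemma colon_up_set:
  assumes U: "U \<subseteq> expos n" "up_set n (min_elems n U) = U" and G: "G = min_elems n U"
    and J: "\<And>u. u \<in> G \<Longrightarrow> u = list_expo (J u) \<and> spread t (J u) \<and> set (J u) \<subseteq> {1..n} \<and> length (J u) \<le> d"
    and u: "u \<in> G" "u \<noteq> 0" and S: "S \<subseteq> G" "u \<notin> S"
    and le: "\<And>w. w \<in> S \<Longrightarrow> (deg w, weight w) \<le> (deg u, weight u)"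
    and less: "\<And>w. w \<in> G \<Longrightarrow> (deg w, weight w) < (deg u, weight u) \<Longrightarrow> w \<in> S"
  shows "{w \<in> expos n. u + w \<in> up_set n S} = {w \<in> expos n. colon_vars t (J u) \<inter> keys w \<noteq> {}}"
proof (intro Collect_cong conj_cong refl iffI)
  fix w assume w: "w \<in> expos n" "u + w \<in> up_set n S"
  then obtain a v where a: "a \<in> S" "u + w = a + v" by (auto elim: up_setE)
  have "a \<in> G" "a \<noteq> u" using a S by auto
  then obtain i where i: "i \<in> colon_vars t (J u)" "lookup u i < lookup a i"
    using colon_up_set_subset[OF G u(1), of "J u" a "J a"] J[OF u(1)] J[of a] le[OF a(1)] by metis
  have "lookup u i + lookup w i = lookup a i + lookup v i"
    using arg_cong[OF a(2), of "\<lambda>p. lookup p i"] by (simp add: lookup_add)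
  then have "i \<in> keys w" using i(2) by (simp add: in_keys_iff)
  then show "colon_vars t (J u) \<inter> keys w \<noteq> {}" using i(1) by blast
next
  fix w assume w: "w \<in> expos n" "colon_vars t (J u) \<inter> keys w \<noteq> {}"
  then obtain i where i: "i \<in> colon_vars t (J u)" "i \<in> keys w" by blast
  let ?js = "J u"
  have js: "u = list_expo ?js" "spread t ?js" "set ?js \<subseteq> {1..n}" "length ?js \<le> d" using J[OF u(1)] by auto
  have "list_expo ?js \<in> U" "?js \<noteq> []" using u G js(1) by (auto simp: min_elems_def)
  then obtain k where k: "k < length ?js" "i < ?js ! k" "list_expo (?js[k := i]) \<in> U"
    using colon_var_exchange[OF js(2,3,4) _ _ i(1)] by blast
  obtain g z where g: "g \<in> G" "z \<in> expos n" "list_expo (?js[k := i]) = g + z"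
    using k(3) U(2) G by (metis up_setE)
  \<comment> \<open>Either \<open>g\<close> is the exchanged monomial itself, with the degree of
    \<open>u\<close> and smaller weight, or a proper divisor of it, with smaller degree.\<close>
  have "(deg g, weight g) < (deg u, weight u)"
  proof (cases "z = 0")
    case True
    then have "g = list_expo (?js[k := i])" using g(3) by simp
    moreover have "deg u = length ?js" "weight u = sum_list ?js"
      using js(1) deg_list_expo weight_list_expo by metis+
    ultimately show ?thesis
      using sum_list_update_less[OF k(1,2)] by (simp add: deg_list_expo weight_list_expo)
  next
    case False
    have "deg g + deg z = deg u"
      using arg_cong[OF g(3), of deg] arg_cong[OF js(1), of deg] by (simp add: deg_add deg_list_expo)
    moreover have "deg z > 0" using False deg_eq_0_iff by blast
    ultimately have "deg g < deg u" by linarith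
    then show ?thesis by simp
  qed
  then have gS: "g \<in> S" using less g(1) by blast
  let ?w = "w - Poly_Mapping.single i 1" and ?x = "Poly_Mapping.single (?js ! k) (1::nat)"
  have weq: "w = Poly_Mapping.single i 1 + ?w"
    using i(2) by (intro poly_mapping_eqI) (auto simp: lookup_add lookup_minus lookup_single when_def in_keys_iff)
  have "u + w = (list_expo ?js + Poly_Mapping.single i 1) + ?w"
    using weq js(1) by (metis add.assoc)
  also have "\<dots> = g + (z + ?x + ?w)"
    unfolding list_expo_update[OF k(1), symmetric] g(3) by (simp add: add.assoc)
  finally have "u + w = g + (z + ?x + ?w)" .
  moreover have "?w \<in> expos n" using w(1) keys_plus_expo[of "Poly_Mapping.single i 1" ?w] weq
    unfolding expos_def by (metis (no_types, lifting) Un_subset_iff mem_Collect_eq)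
  moreover have "?x \<in> expos n" using js(3) nth_mem[OF k(1)] by (auto simp: expos_def)
  ultimately show "u + w \<in> up_set n S"
    using up_setI[OF gS] expos_add g(2) by metis
qed

end

section \<open>Betti numbers\<close>

text \<open>The degree bound \<open>d\<close> leaves finitely many index lists, so the set of
  generators is finite without appeal to the Noetherian property.\<close>

lemma finite_t_spread: "finite {u. t_spread n d t u}"
proof (rule finite_subset)
  show "{u. t_spread n d t u} \<subseteq> list_expo ` {js. set js \<subseteq> {1..n} \<and> length js \<le> d}"
    by (auto simp: t_spread_iff)
  show "finite (list_expo ` {js. set js \<subseteq> {1..n} \<and> length js \<le> d})"
    by (intro finite_imageI finite_lists_length_le) simp
qed

text \<open>Properness excludes the generator 1. For I = S its \<open>max_var\<close> is
  \<open>n\<close> by convention, and the right-hand side would predict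
  \<open>(n - 1) choose i\<close> in place of a single Betti number at \<open>i = 0\<close>.\<close>

theorem betti_t_spread_strongly_stable:
  fixes I :: "'k::field mpol set"
  assumes st: "t_spread_strongly_stable n d t I" and proper: "I \<noteq> carrier (poly_ring n)"
  shows "betti n I i j = (\<Sum>u\<in>min_gens n I. if j = int (deg u + i)
      then (max_var n u - 1 - (\<Sum>l = 1..deg u - 1. t l)) choose i else 0)"
    and "finite (min_gens n I)"
proof -
  obtain A where A: "A \<subseteq> expos n" "I = genideal (poly_ring n) (monom ` A)"
    using st unfolding t_spread_strongly_stable_def t_spread_ideal_def monomial_ideal_def by blast
  define U where "U = up_set n A"
  define G where "G = min_elems n U"
  have I: "I = mpol_span U" unfolding A(2) U_def by (rule genideal_monom[OF A(1)])
  have gens: "min_gens n I = G" unfolding I U_def G_def by (rule min_gens_eq[OF A(1)])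
  have U: "U \<subseteq> expos n" "up_set n G = U"
    unfolding U_def G_def using up_set_expos[OF A(1)] up_set_min_elems[OF A(1)] by auto
  have t_spread: "t_spread n d t u" if "u \<in> G" for u
    using st that unfolding t_spread_strongly_stable_def t_spread_ideal_def gens by blast
  then have finG: "finite G" using finite_subset[OF _ finite_t_spread] by blast
  have G: "G \<subseteq> expos n" using U(1) by (auto simp: G_def min_elems_def)
  have "0 \<notin> G"
  proof
    assume "0 \<in> G"
    then have "expos n \<subseteq> U" using up_setI[of 0 G _ n] U(2) by auto
    then show False using U(1) proper by (auto simp: I mpol_span_def carrier_poly_ring)
  qed
  obtain J where J: "\<And>u. u \<in> G \<Longrightarrow> u = list_expo (J u) \<and> spread t (J u) \<and> set (J u) \<subseteq> {1..n} \<and> length (J u) \<le> d"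
    using t_spread unfolding t_spread_iff by metis
  interpret stable_up_set n d t U
  proof
    fix js k i
    assume js: "spread t js" "set js \<subseteq> {1..n}" "length js \<le> d" "list_expo js \<in> U"
      "k < length js" "1 \<le> i" "i < js ! k" "spread t (js[k := i])"
    have "t_spread n d t (list_expo js)" using js t_spread_iff by blast
    moreover have "js ! k \<in> keys (list_expo js)" using js(5) by (simp add: keys_list_expo)
    moreover have "set (js[k := i]) \<subseteq> {1..n}"
      using js nth_mem[OF js(5)] set_update_subset_insert[of js k i] by fastforce
    then have "t_spread n d t (list_expo (js[k := i]))"
      using js t_spread_iff by (metis length_list_update)
    ultimately have "monom (list_expo (js[k := i])) \<in> I"
      using st js(4,7) list_expo_update_eq[OF js(5), of i]
      unfolding t_spread_strongly_stable_def by (metis I monom_mem_mpol_span)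
    then show "list_expo (js[k := i]) \<in> U" unfolding I by simp
  qed
  have V: "colon_vars t (J u) \<subseteq> {1..n}" if "u \<in> G" for u
  proof -
    have "J u \<noteq> []" using J[OF that] that \<open>0 \<notin> G\<close> by auto
    then have "last (J u) \<le> n" using J[OF that] last_in_set[of "J u"] by fastforce
    then show ?thesis by (auto simp: colon_vars_def)
  qed
  have card_V: "card (colon_vars t (J u)) = max_var n u - 1 - (\<Sum>l = 1..deg u - 1. t l)" if "u \<in> G" for u
  proof -
    have ne: "J u \<noteq> []" "u \<noteq> 0" using J[OF that] that \<open>0 \<notin> G\<close> by auto
    have Ju: "keys u = set (J u)" "deg u = length (J u)"
      using J[OF that] keys_list_expo deg_list_expo by metis+
    have "sorted (J u)" using J[OF that] spread_sorted by blast
    then have "x \<le> last (J u)" if "x \<in> set (J u)" for x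
      using that sorted_nth_mono[of "J u"] ne(1) by (metis in_set_conv_nth last_conv_nth Suc_pred' diff_less length_greater_0_conv less_Suc_eq_le zero_less_one)
    then have "max_var n u = last (J u)"
      unfolding max_var_def Ju using ne by (auto intro: Max_eqI)
    moreover have "0 \<notin> set (J u)" using J[OF that] by auto
    ultimately show ?thesis
      using card_colon_vars[of t "J u"] J[OF that] ne(1) Ju(2) by simp
  qed
  obtain r s and D :: "nat \<Rightarrow> nat \<Rightarrow> nat \<Rightarrow> 'k mpol"
    where res: "aug_resolution n (mpol_span (up_set n G)) r s D" "\<And>i. const_mat (D i) = 0"
      and card: "\<And>i j. card {k. k < r (Suc i) \<and> s (Suc i) k = j} =
         (\<Sum>u\<in>G. if j = int (deg u + i) then card (colon_vars t (J u)) choose i else 0)"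
  proof -
    have "\<exists>r s (D :: nat \<Rightarrow> nat \<Rightarrow> nat \<Rightarrow> 'k mpol).
      aug_resolution n (mpol_span (up_set n G)) r s D \<and> (\<forall>i. const_mat (D i) = 0) \<and>
      (\<forall>i j. card {k. k < r (Suc i) \<and> s (Suc i) k = j} =
        (\<Sum>u\<in>G. if j = int (deg u + i) then card (colon_vars t (J u)) choose i else 0))"
    proof (rule resolution_linear_quotients[where f = "\<lambda>u. (deg u, weight u)"])
      fix u S
      assume "u \<in> G" "S \<subseteq> G" "u \<notin> S" "\<And>w. w \<in> S \<Longrightarrow> (deg w, weight w) \<le> (deg u, weight u)"
        "\<And>w. w \<in> G \<Longrightarrow> (deg w, weight w) < (deg u, weight u) \<Longrightarrow> w \<in> S"
      moreover from this have "u \<noteq> 0" using \<open>0 \<notin> G\<close> by auto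
      ultimately show "{w \<in> expos n. u + w \<in> up_set n S} = {w \<in> expos n. colon_vars t (J u) \<inter> keys w \<noteq> {}}"
        using U unfolding G_def by (intro colon_up_set[OF _ _ refl] J[unfolded G_def]) blast+
    qed (use finG G \<open>0 \<notin> G\<close> V in auto)
    then show thesis using that by blast
  qed
  \<comment> \<open>Dropping index 0 passes from the resolution of S/I to that of I.\<close>
  define F where "F = \<lparr>rank = (\<lambda>i. r (Suc i)), shift = (\<lambda>i. s (Suc i)), aug = D 0 0, dmat = (\<lambda>i. D (Suc i))\<rparr>"
  have "graded_free_resolution n I F"
    using graded_free_resolution_of_aug[OF res(1)] unfolding F_def U(2) I .
  then have "betti n I i j = tor_dim F i j" by (simp add: betti_eq_tor_dim)
  also have "\<dots> = card {k. k < r (Suc i) \<and> s (Suc i) k = j}"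
    using fun_cong[OF fun_cong[OF res(2)]] by (subst tor_dim_minimal) (simp_all add: F_def const_mat_def)
  also have "\<dots> = (\<Sum>u\<in>G. if j = int (deg u + i)
      then (max_var n u - 1 - (\<Sum>l = 1..deg u - 1. t l)) choose i else 0)"
    unfolding card using card_V by (intro sum.cong) auto
  finally show "betti n I i j = (\<Sum>u\<in>min_gens n I. if j = int (deg u + i)
      then (max_var n u - 1 - (\<Sum>l = 1..deg u - 1. t l)) choose i else 0)"
    unfolding gens .
  show "finite (min_gens n I)" unfolding gens by (rule finG)
qed

lemma fps_nth_one_plus_X_power: "fps_nth ((1 + fps_X) ^ m :: int fps) i = int (m choose i)"
proof (induction m arbitrary: i)
  case 0
  then show ?case by (cases i) auto
next
  case (Suc m)
  then show ?case by (cases i) (simp_all add: distrib_right)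
qed

theorem corollary5p3:
  fixes n d :: nat and t :: "nat \<Rightarrow> nat" and I :: "'k::field mpol set"
  assumes "d \<ge> 2"
    and "t_spread_strongly_stable n d t I"
    and "I \<noteq> carrier (poly_ring n)"
  shows "poincare_series n I =
           (\<Sum>u \<in> min_gens n I. (1 + fps_X) ^ (max_var n u - 1 - (\<Sum>l = 1..deg u - 1. t l)))
       \<and> pd n I = Max ((\<lambda>u. max_var n u - 1 - (\<Sum>j = 1..deg u - 1. t j)) ` min_gens n I)
       \<and> reg n I = Max ((\<lambda>u. int (deg u)) ` min_gens n I)"
proof -
  define G where "G = min_gens n I"
  define c where "c = (\<lambda>u. max_var n u - 1 - (\<Sum>l = 1..deg u - 1. t l))"
  have betti: "betti n I i j = (\<Sum>u\<in>G. if j = int (deg u + i) then c u choose i else 0)" for i j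
    unfolding G_def c_def by (rule betti_t_spread_strongly_stable(1)[OF assms(2,3)])
  have fin: "finite G" unfolding G_def by (rule betti_t_spread_strongly_stable(2)[OF assms(2,3)])
  \<comment> \<open>The summands are natural numbers, so nothing cancels, and a binomial coefficient
    is nonzero exactly for \<open>i \<le> c u\<close>.\<close>
  have nz: "betti n I i j \<noteq> 0 \<longleftrightarrow> (\<exists>u\<in>G. j = int (deg u + i) \<and> i \<le> c u)" for i j
    using fin by (auto simp: betti binomial_eq_0_iff not_less split: if_splits)
  have total: "total_betti n I i = (\<Sum>u\<in>G. c u choose i)" for i
  proof -
    have "total_betti n I i = (\<Sum>j\<in>(\<lambda>u. int (deg u + i)) ` G. betti n I i j)"
      unfolding total_betti_def using fin nz by (intro sum.mono_neutral_left) auto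
    also have "\<dots> = (\<Sum>u\<in>G. \<Sum>j\<in>(\<lambda>u. int (deg u + i)) ` G. if j = int (deg u + i) then c u choose i else 0)"
      unfolding betti by (rule sum.swap)
    \<comment> \<open>For fixed \<open>i\<close> each generator contributes in exactly one degree
      \<open>j\<close>.\<close>
    also have "\<dots> = (\<Sum>u\<in>G. c u choose i)"
      using fin by (intro sum.cong refl) simp
    finally show ?thesis .
  qed
  have "poincare_series n I = (\<Sum>u\<in>G. (1 + fps_X) ^ c u)"
    by (rule fps_ext) (simp add: poincare_series_def total fps_sum_nth fps_nth_one_plus_X_power)
  moreover have "pd n I = Max (c ` G)"
  \<comment> \<open>For I = 0 both sides are \<open>Max\<close> of the empty set.\<close>
  proof (cases "G = {}")
    case True
    then show ?thesis by (simp add: pd_def total)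
  next
    case False
    have "{i. total_betti n I i \<noteq> 0} = {i. \<exists>u\<in>G. i \<le> c u}"
      using fin by (auto simp: total binomial_eq_0_iff not_less)
    moreover have "Max {i. \<exists>u\<in>G. i \<le> c u} = Max (c ` G)"
    proof (rule Max_eqI)
      show "finite {i. \<exists>u\<in>G. i \<le> c u}"
        using fin by (auto intro: finite_subset[of _ "\<Union>u\<in>G. {..c u}"])
      show "i \<le> Max (c ` G)" if "i \<in> {i. \<exists>u\<in>G. i \<le> c u}" for i
        using that fin by (auto intro: order_trans Max_ge)
      have "Max (c ` G) \<in> c ` G" using fin False by (intro Max_in) auto
      then obtain u where "u \<in> G" "Max (c ` G) = c u" by blast
      then show "Max (c ` G) \<in> {i. \<exists>u\<in>G. i \<le> c u}" by auto
    qed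
    ultimately show ?thesis by (simp add: pd_def)
  qed
  \<comment> \<open>Every generator already contributes at \<open>i = 0\<close>, so all degrees of
    generators occur, and by \<open>nz\<close> no others.\<close>
  moreover have "{j. \<exists>i. betti n I i (int i + j) \<noteq> 0} = (\<lambda>u. int (deg u)) ` G"
    unfolding nz by auto
  then have "reg n I = Max ((\<lambda>u. int (deg u)) ` G)" by (simp add: reg_def)
  ultimately show ?thesis by (simp add: G_def c_def)
qed

end
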